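(* There exists a nonsingular $\mathbb{Z}$-system which is EIC but not DE.
   Context: A nonsingular $\mathbb{Z}$-system is a measurable action of $\mathbb{Z}$ on a standard Lebesgue probability space $(X,\mathcal{B},\mu)$ preserving the measure class of $\mu$ (generated by a single invertible nonsingular transformation $T$). Ergodic: every $B\in\mathcal{B}$ with $\mu(TB\,\triangle\,B)=0$ has $\mu(B)\in\{0,1\}$. DE (doubly ergodic): the diagonal action $T\times T$ on $(X\times X,\mu\times\mu)$ is ergodic. EIC (ergodic with isometric coefficients): there is no non-constant Borel measurable equivariant map $\phi:X\to Z$, where $(Z,d)$ is a separable metric space on which $\mathbb{Z}$ acts by isometries (equivariant: $\phi(Tx)=U\phi(x)$ for $\mu$-a.e. $x$, where $U$ is the isometry by which the generator acts; non-constant: not $\mu$-a.e. equal to a constant). *)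

theory Defs
  imports "HOL-Probability.Probability"
begin

definition standard_borel :: "'a measure \<Rightarrow> bool" where
  "standard_borel M \<longleftrightarrow>
     (\<exists>X. completely_metrizable_space X \<and> second_countable X \<and>
          topspace X = space M \<and> sets M = sigma_sets (space M) {V. openin X V})"

definition standard_prob_space :: "'a measure \<Rightarrow> bool" where
  "standard_prob_space M \<longleftrightarrow> prob_space M \<and> standard_borel M"

definition nonsingular_Z_system :: "'a measure \<Rightarrow> ('a \<Rightarrow> 'a) \<Rightarrow> bool" where
  "nonsingular_Z_system M T \<longleftrightarrow>
     standard_prob_space M \<and>
     bij_betw T (space M) (space M) \<and>
     T \<in> measurable M M \<and>
     inv_into (space M) T \<in> measurable M M \<and>
     (\<forall>B \<in> sets M. emeasure M (T ` B) = 0 \<longleftrightarrow> emeasure M B = 0)"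

definition ergodic :: "'a measure \<Rightarrow> ('a \<Rightarrow> 'a) \<Rightarrow> bool" where
  "ergodic M T \<longleftrightarrow>
     (\<forall>B \<in> sets M. measure M ((T ` B - B) \<union> (B - T ` B)) = 0 \<longrightarrow>
        measure M B = 0 \<or> measure M B = 1)"

definition doubly_ergodic :: "'a measure \<Rightarrow> ('a \<Rightarrow> 'a) \<Rightarrow> bool" where
  "doubly_ergodic M T \<longleftrightarrow> ergodic (M \<Otimes>\<^sub>M M) (\<lambda>(x, y). (T x, T y))"

text \<open>The action of \<open>\<int>\<close> by isometries is given by its generator \<open>U\<close>.\<close>

definition isometric_coefficient ::
    "'a measure \<Rightarrow> ('a \<Rightarrow> 'a) \<Rightarrow> 'z set \<Rightarrow> ('z \<Rightarrow> 'z \<Rightarrow> real) \<Rightarrow> ('z \<Rightarrow> 'z) \<Rightarrow> ('a \<Rightarrow> 'z) \<Rightarrow> bool"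
where
  "isometric_coefficient M T Z d U \<phi> \<longleftrightarrow>
     Metric_space Z d \<and>
     separable_space (Metric_space.mtopology Z d) \<and>
     bij_betw U Z Z \<and>
     (\<forall>x \<in> Z. \<forall>y \<in> Z. d (U x) (U y) = d x y) \<and>
     \<phi> \<in> measurable M (sigma Z {V. openin (Metric_space.mtopology Z d) V}) \<and>
     (AE x in M. \<phi> (T x) = U (\<phi> x))"

text \<open>
  HOL cannot quantify over types inside a formula. The metric spaces below therefore have a carrier
  \<open>Z :: real set\<close>, with an arbitrary metric \<open>d\<close> unrelated to the usual distance on the reals. This
  loses no generality, since a separable metric space has at most the cardinality of the continuum:
  \<open>EIC_any_carrier\<close> below gives the property for carriers in every type.
\<close>

definition EIC :: "'a measure \<Rightarrow> ('a \<Rightarrow> 'a) \<Rightarrow> bool" where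
  "EIC M T \<longleftrightarrow>
     \<not> (\<exists>(Z :: real set) d U \<phi>. isometric_coefficient M T Z d U \<phi> \<and>
           \<not> (\<exists>c \<in> Z. AE x in M. \<phi> x = c))"

lemma separable_metric_lepoll_real:
  assumes "Metric_space Z d" and "separable_space (Metric_space.mtopology Z d)"
  shows "Z \<lesssim> (UNIV :: real set)"
proof -
  interpret Metric_space Z d by fact
  obtain C where C: "countable C" "C \<subseteq> Z" "mtopology closure_of C = Z"
    using assms(2) by (auto simp: separable_space_def)
  define g where
    "g z = {prod_encode (n, k) | n k. d (from_nat_into C n) z < 1 / Suc k}" for z
  have "inj_on g Z"
  proof (rule inj_onI, rule ccontr)
    fix z w assume zw: "z \<in> Z" "w \<in> Z" "g z = g w" "z \<noteq> w"
    then have pos: "d z w > 0" by simp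
    obtain k where k: "1 / real (Suc k) < d z w / 2"
      using reals_Archimedean[of "d z w / 2"] pos by (auto simp: inverse_eq_divide)
    have "z \<in> mtopology closure_of C" using C zw by simp
    moreover have "(0::real) < 1 / real (Suc k)" by simp
    ultimately obtain c where c: "c \<in> C" "d z c < 1 / real (Suc k)"
      unfolding metric_closure_of in_mball by blast
    obtain n where n: "from_nat_into C n = c"
      using c C from_nat_into_surj by metis
    have "prod_encode (n, k) \<in> g z"
      using c n by (auto simp: g_def commute)
    then have "prod_encode (n, k) \<in> g w" using zw by simp
    then have "d c w < 1 / real (Suc k)"
      using n by (auto simp: g_def prod_encode_eq)
    moreover have "d z w \<le> d z c + d c w" using triangle zw c C by blast
    ultimately show False using c k by linarith
  qed
  then have "Z \<lesssim> (UNIV :: nat set set)" by (auto simp: lepoll_def)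
  then show ?thesis using nat_sets_eqpoll_reals lepoll_trans2 by blast
qed

lemma EIC_any_carrier:
  fixes Z :: "'z set"
  assumes "EIC M T" and coeff: "isometric_coefficient M T Z d U \<phi>"
  shows "\<exists>c \<in> Z. AE x in M. \<phi> x = c"
proof -
  have ms: "Metric_space Z d"
    and sep: "separable_space (Metric_space.mtopology Z d)"
    and bij: "bij_betw U Z Z"
    and iso: "\<And>x y. x \<in> Z \<Longrightarrow> y \<in> Z \<Longrightarrow> d (U x) (U y) = d x y"
    and meas: "\<phi> \<in> measurable M (sigma Z {V. openin (Metric_space.mtopology Z d) V})"
    and equiv: "AE x in M. \<phi> (T x) = U (\<phi> x)"
    using coeff by (auto simp: isometric_coefficient_def)
  interpret A: Metric_space Z d by fact
  have subZ: "{V. openin A.mtopology V} \<subseteq> Pow Z"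
    using openin_subset by fastforce
  obtain f :: "'z \<Rightarrow> real" where f: "inj_on f Z"
    using separable_metric_lepoll_real[OF ms sep] by (auto simp: lepoll_def)
  define g where "g = inv_into Z f"
  define Z' where "Z' = f ` Z"
  define d' where "d' x y = d (g x) (g y)" for x y
  define U' where "U' = f \<circ> U \<circ> g"
  have gf: "g (f z) = z" if "z \<in> Z" for z
    using that f by (simp add: g_def)
  have fg: "f (g y) = y" "g y \<in> Z" if "y \<in> Z'" for y
    using that by (auto simp: g_def Z'_def f_inv_into_f inv_into_into)
  have ms': "Metric_space Z' d'"
  proof
    show "0 \<le> d' x y" for x y by (simp add: d'_def)
    show "d' x y = d' y x" for x y by (simp add: d'_def A.commute)
    show "d' x y = 0 \<longleftrightarrow> x = y" if "x \<in> Z'" "y \<in> Z'" for x y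
      using that fg by (metis d'_def A.zero)
    show "d' x z \<le> d' x y + d' y z" if "x \<in> Z'" "y \<in> Z'" "z \<in> Z'" for x y z
      using that fg by (simp add: d'_def A.triangle)
  qed
  interpret B: Metric_space Z' d' by fact
  interpret AB: Metric_space12 Z d Z' d' by unfold_locales
  have hom: "homeomorphic_map A.mtopology B.mtopology f"
    by (rule AB.isometry_imp_homeomorphic_map) (auto simp: Z'_def d'_def gf)
  have sep': "separable_space B.mtopology"
    using sep hom homeomorphic_separable_space homeomorphic_map_imp_homeomorphic_space by blast
  have bijf: "bij_betw f Z Z'" using f by (simp add: Z'_def bij_betw_def)
  have bijg: "bij_betw g Z' Z" unfolding g_def by (rule bij_betw_inv_into[OF bijf])
  have bij': "bij_betw U' Z' Z'"
    unfolding U'_def using bijf bijg bij by (blast intro: bij_betw_trans)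
  have UZ: "U z \<in> Z" if "z \<in> Z" for z using bij that by (auto simp: bij_betw_def)
  have iso': "d' (U' x) (U' y) = d' x y" if "x \<in> Z'" "y \<in> Z'" for x y
    using that fg by (simp add: d'_def U'_def gf UZ iso)
  have spA: "space (sigma Z {V. openin A.mtopology V}) = Z"
    using subZ by (simp add: space_measure_of)
  have \<phi>Z: "\<phi> x \<in> Z" if "x \<in> space M" for x
    using measurable_space[OF meas that] spA by simp
  have meas': "f \<circ> \<phi> \<in> measurable M (sigma Z' {V. openin B.mtopology V})"
  proof (rule measurable_sigma_sets)
    show "sets (sigma Z' {V. openin B.mtopology V}) = sigma_sets Z' {V. openin B.mtopology V}"
      by (rule sets_measure_of) (use openin_subset in fastforce)
    show "{V. openin B.mtopology V} \<subseteq> Pow Z'" using openin_subset by fastforce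
    show "f \<circ> \<phi> \<in> space M \<rightarrow> Z'" using \<phi>Z by (auto simp: Z'_def)
    fix V assume "V \<in> {V. openin B.mtopology V}"
    then have "openin A.mtopology {z \<in> topspace A.mtopology. f z \<in> V}"
      using openin_continuous_map_preimage[OF homeomorphic_imp_continuous_map[OF hom]] by blast
    then have "{z \<in> Z. f z \<in> V} \<in> sets (sigma Z {V. openin A.mtopology V})"
      using subZ by (simp add: sets_measure_of sigma_sets.Basic)
    from measurable_sets[OF meas this]
    have "\<phi> -` {z \<in> Z. f z \<in> V} \<inter> space M \<in> sets M" .
    moreover have "\<phi> -` {z \<in> Z. f z \<in> V} \<inter> space M = (f \<circ> \<phi>) -` V \<inter> space M"
      using \<phi>Z by auto
    ultimately show "(f \<circ> \<phi>) -` V \<inter> space M \<in> sets M" by simp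
  qed
  have equiv': "AE x in M. (f \<circ> \<phi>) (T x) = U' ((f \<circ> \<phi>) x)"
    using equiv AE_space by eventually_elim (simp add: U'_def gf \<phi>Z)
  have "isometric_coefficient M T Z' d' U' (f \<circ> \<phi>)"
    unfolding isometric_coefficient_def using ms' sep' bij' iso' meas' equiv' by blast
  then obtain c where c: "c \<in> Z'" "AE x in M. (f \<circ> \<phi>) x = c"
    using assms(1) unfolding EIC_def by blast
  have "AE x in M. \<phi> x = g c"
    using c(2) AE_space by eventually_elim (use gf \<phi>Z in force)
  then show ?thesis using fg c(1) by blast
qed

end

(* The system is a rank-one transformation of infinite type, realised as the shift on sequences
   indexed by the integers. A random address x, with independent digits x k = (n, j), is coded by the
   set occ x of all finite sums of the differences jump (y k) - jump (x k), y running through the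
   finite changes of x. Changing finitely many digits translates occ x.

   Not doubly ergodic: the intersection of the two coded sets is moved along by the diagonal
   action, so its cardinality is invariant. The jumps form a Sidon set up to the perturbation by 1, and
   therefore the intersection is {0} when all n-digits of the two addresses differ, which has positive
   probability; it has more elements when the first digits agree.

   EIC: let phi be equivariant for an isometry U. Rotating the j-digit far out hardly changes a
   measurable set, so there are three addresses with digits (n, 0), (n, 1), (n, 2) at one place whose
   images lie close together. The translations between them are by a and a + 1, hence U nearly fixes
   a point. So U fixes phi almost everywhere, phi does not depend on finitely many digits, and a
   zero-one law makes it constant. *)
theory Submission
  imports Defs
begin

section \<open>Return times of the rank-one construction\<close>

text \<open>For fixed \<open>n\<close> the values at \<open>j = 0, 1, 2\<close> have consecutive differences \<open>a\<close> and \<open>a + 1\<close>, where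
  \<open>a = 16 ^ (2 * n)\<close>.\<close>

definition jump :: "nat \<times> nat \<Rightarrow> int" where
  "jump = (\<lambda>(n, j). 16 ^ (2 * n + 1) + int j * 16 ^ (2 * n) + (if j = 2 then 1 else 0))"

section \<open>Sidon property of the leading parts\<close>

definition lead :: "nat \<Rightarrow> nat \<Rightarrow> int" where
  "lead n j = 16 ^ (2 * n) * (16 + int j)"

lemma jump_eq: "jump (n, j) = lead n j + (if j = 2 then 1 else 0)"
  by (simp add: jump_def lead_def algebra_simps)

text \<open>The factor \<open>16 + int i\<close> is at most 18, and 8 * 18 = 144 stays below 256 =
  16 ^ 2, the ratio of consecutive scales. The factor 8 leaves room for sums of several smaller
  terms.\<close>

lemma lead_less:
  assumes "n < m" "i < 3"
  shows "8 * lead n i < 16 ^ (2 * m)"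
proof -
  have "8 * lead n i \<le> 16 ^ (2 * n) * 144"
    using assms by (simp add: lead_def)
  also have "\<dots> < 16 ^ (2 * n) * (16 ^ 2 :: int)" by simp
  also have "\<dots> = 16 ^ (2 * (n + 1))" by (simp add: power_add)
  also have "\<dots> \<le> 16 ^ (2 * m)" using assms by (intro power_increasing) auto
  finally show ?thesis .
qed

lemma lead_nonneg: "0 \<le> lead n i" by (simp add: lead_def)

lemma lead_inj:
  assumes "lead n i = lead m j" "i < 3" "j < 3"
  shows "n = m \<and> i = j"
proof -
  have ge: "16 ^ (2 * n) \<le> lead n i" for n i by (simp add: lead_def)
  have "n = m"
    using assms lead_less[of n m i] lead_less[of m n j] ge[of m j] ge[of n i] lead_nonneg
    by (smt (verit) linorder_neqE_nat)
  then show ?thesis using assms by (simp add: lead_def)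
qed

text \<open>Everything is measured against the scale \<open>q\<close> of the larger index
  \<open>u\<close>. A \<open>v\<close> or \<open>v'\<close> on a wrong scale unbalances the two
  sides, because the smaller terms together cannot reach one unit of a larger scale; on equal scales
  the coefficients are compared.\<close>

lemma lead_sidon_aux:
  assumes eq: "lead v j + lead u' i' = lead u i + lead v' j'"
    and lt: "u' < u" and small: "i < 3" "j < 3" "i' < 3" "j' < 3"
  shows "v = u \<and> j = i \<and> v' = u' \<and> j' = i'"
proof -
  define q :: int where "q = 16 ^ (2 * u)"
  have q: "0 < q" by (simp add: q_def)
  have u: "lead u i = q * (16 + int i)" for i by (simp add: lead_def q_def)
  have u': "8 * lead u' i' < q" unfolding q_def using lt small by (intro lead_less)
  have le_v: "8 * lead v j < q" if "v < u" unfolding q_def using that small by (intro lead_less)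
  have le_v': "8 * lead v' j' < q" if "v' < u" unfolding q_def using that small by (intro lead_less)
  have up: "8 * lead w k < 16 ^ (2 * v)" if "w < v" "k < 3" for w k
    using that by (intro lead_less)
  have up': "8 * lead w k < 16 ^ (2 * v')" if "w < v'" "k < 3" for w k
    using that by (intro lead_less)
  have val: "16 ^ (2 * w) * 16 \<le> lead w k" for w k by (simp add: lead_def)
  have top: "lead w k \<le> 16 ^ (2 * w) * 18" if "k < 3" for w k
    using that by (simp add: lead_def)
  have pos: "0 < (16::int) ^ (2 * w)" for w by simp
  have qi: "q * 16 \<le> q * (16 + int i)" using q by simp
  consider "v < u" | "v = u" | "v > u" by linarith
  then show ?thesis
  proof cases
    case 1
    then show ?thesis
      using eq u' le_v u[of i] qi q lead_nonneg[of v' j'] by linarith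
  next
    case 2
    have *: "q * (16 + int j) + lead u' i' = q * (16 + int i) + lead v' j'"
      using eq u[of i] u[of j] 2 by simp
    consider "v' < u" | "v' = u" | "v' > u" by linarith
    then show ?thesis
    proof cases
      case 1
      have "j = i"
      proof (rule ccontr)
        assume "j \<noteq> i"
        then have "\<bar>int j - int i\<bar> \<ge> 1" by linarith
        then have "q \<le> \<bar>q * (int j - int i)\<bar>" using q by (simp add: abs_mult)
        moreover have "q * (int j - int i) = lead v' j' - lead u' i'"
          using * by (simp add: algebra_simps)
        ultimately show False
          using le_v'[OF 1] u' lead_nonneg[of v' j'] lead_nonneg[of u' i'] by linarith
      qed
      with * have "lead v' j' = lead u' i'" by simp
      with lead_inj small 2 \<open>j = i\<close> show ?thesis by blast
    next
      case c: 2
      have "q * (16 + int j) \<le> q * 18" using q small by simp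
      moreover have "q * 16 \<le> lead v' j'" using val[of u j'] c by (simp add: q_def)
      ultimately show ?thesis using * u' q qi by linarith
    next
      case 3
      have "q * (16 + int j) \<le> q * 18" using q small by simp
      moreover have "8 * lead u j < 16 ^ (2 * v')" using up'[OF 3] small by blast
      ultimately show ?thesis
        using * u[of j] u' val[of v' j'] q qi pos[of v'] by linarith
    qed
  next
    case 3
    have uv: "8 * lead u i < 16 ^ (2 * v)" using up[OF 3] small by blast
    consider "v' < v" | "v' = v" | "v' > v" by linarith
    then show ?thesis
    proof cases
      case 1
      then show ?thesis using eq up[OF 1, of j'] small uv val[of v j] lead_nonneg[of u' i'] pos[of v]
        by linarith
    next
      case 2
      have *: "lead u' i' - lead u i = 16 ^ (2 * v) * (int j' - int j)"
        using eq 2 by (simp add: lead_def algebra_simps)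
      have "j = j'"
      proof (rule ccontr)
        assume "j \<noteq> j'"
        then have "\<bar>int j' - int j\<bar> \<ge> 1" by linarith
        then have "16 ^ (2 * v) \<le> \<bar>16 ^ (2 * v) * (int j' - int j)\<bar>" by (simp add: abs_mult)
        then show False
          using uv u' u[of i] qi q * lead_nonneg[of u i] lead_nonneg[of u' i'] by linarith
      qed
      with * have "lead u' i' = lead u i" by simp
      with lead_inj small lt show ?thesis by blast
    next
      case c: 3
      then show ?thesis using eq up'[OF c, of j] small uv val[of v' j'] u' u[of i] qi q
          lead_nonneg[of u i] pos[of v'] by linarith
    qed
  qed
qed

text \<open>A Sidon equation has two trivial solutions. The one that forces \<open>u = u'\<close> is
  ruled out by hypothesis, so both differences vanish. Exchanging primed and unprimed terms reduces
  to the case \<open>u' < u\<close>.\<close>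

lemma lead_sidon:
  assumes eq: "lead v j + lead u' i' = lead u i + lead v' j'"
    and ne: "u \<noteq> u'" and small: "i < 3" "j < 3" "i' < 3" "j' < 3"
  shows "v = u \<and> j = i \<and> v' = u' \<and> j' = i'"
proof (cases "u' < u")
  case True
  then show ?thesis using lead_sidon_aux assms by blast
next
  case False
  then have "u < u'" using ne by simp
  then show ?thesis using lead_sidon_aux[of v' j' u i u' i' v j] assms by (simp add: add.commute)
qed

section \<open>Addresses and their heights\<close>

text \<open>The dyadic ranges of first components are disjoint, so that later levels dominate
  earlier ones, and their sizes \<open>2 ^ (k + 2)\<close> make the probabilities of a coincidence
  at level \<open>k\<close> sum to 1/2.\<close>

definition digits :: "nat \<Rightarrow> (nat \<times> nat) set" where
  "digits k = {2 ^ (k + 2)..<2 ^ (k + 3)} \<times> {..<3}"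

definition height :: "nat \<Rightarrow> (nat \<Rightarrow> nat \<times> nat) \<Rightarrow> int" where
  "height K x = (\<Sum>k<K. jump (x k))"

abbreviation addresses :: "(nat \<Rightarrow> nat \<times> nat) set" where
  "addresses \<equiv> Pi UNIV digits"

text \<open>The times at which the orbit of the point with address \<open>x\<close> returns to the base of the
  rank-one tower, given by the finite changes of \<open>x\<close>.\<close>

definition occ :: "(nat \<Rightarrow> nat \<times> nat) \<Rightarrow> int set" where
  "occ x = {n. \<exists>K. \<exists>y\<in>addresses. n + height K x = height K y}"

lemma height_Suc: "height (Suc K) x = height K x + jump (x K)"
  by (simp add: height_def)

lemma height_split:
  assumes "K \<le> L"
  shows "height L x = height K x + (\<Sum>k=K..<L. jump (x k))"
  unfolding height_def using assms sum.atLeastLessThan_concat[of 0 K L "\<lambda>k. jump (x k)"]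
  by (simp add: atLeast0LessThan)

lemma digitsE:
  assumes "v \<in> digits k"
  obtains n j where "v = (n, j)" "2 ^ (k + 2) \<le> n" "n < 2 ^ (k + 3)" "j < 3"
  using assms by (cases v) (auto simp: digits_def)

lemma jump_nonneg: "0 \<le> jump v"
  by (cases v) (simp add: jump_def)

lemma jump_bound:
  assumes "v \<in> digits k"
  shows "8 * jump v \<le> 16 ^ (2 ^ (k + 4))"
proof -
  obtain n j where v: "v = (n, j)" "n < 2 ^ (k + 3)" "j < 3" using assms by (rule digitsE)
  have "int j * 16 ^ (2 * n) \<le> 2 * 16 ^ (2 * n)" using v(3) by simp
  moreover have "jump v \<le> 16 ^ (2 * n) * 16 + int j * 16 ^ (2 * n) + 1"
    using v by (simp add: jump_def)
  ultimately have "jump v \<le> 16 ^ (2 * n) * 18 + 1" by linarith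
  also have "\<dots> \<le> 16 ^ (2 * n) * 32"
    using one_le_power[of "16::int" "2 * n"] by linarith
  finally have "8 * jump v \<le> 16 ^ (2 * n) * 256" by simp
  also have "\<dots> = (16::int) ^ (2 * n + 2)" by (simp add: power_add)
  also have "\<dots> \<le> 16 ^ (2 ^ (k + 4))"
  proof (rule power_increasing)
    have "(2::nat) ^ (k + 4) = 2 * 2 ^ (k + 3)" by (simp add: power_add)
    with v(2) show "2 * n + 2 \<le> 2 ^ (k + 4)" by linarith
  qed simp
  finally show ?thesis .
qed

text \<open>Passing to the next level squares \<open>16 ^ (2 ^ (K + 3))\<close>, and the previous
  height and the new jump each use at most half of the square.\<close>

lemma height_bound:
  assumes "x \<in> addresses"
  shows "0 \<le> height K x" "4 * height K x \<le> 16 ^ (2 ^ (K + 3))"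
proof -
  show "0 \<le> height K x" by (simp add: height_def sum_nonneg jump_nonneg)
  show "4 * height K x \<le> 16 ^ (2 ^ (K + 3))"
  proof (induction K)
    case 0
    then show ?case by (simp add: height_def)
  next
    case (Suc K)
    define q :: int where "q = 16 ^ (2 ^ (K + 3))"
    have qq: "16 ^ (2 ^ (K + 4)) = q * q"
      by (simp add: q_def flip: power_add) (simp add: power_add)
    have "2 \<le> q" unfolding q_def using power_increasing[of 1 "2 ^ (K + 3)" "16::int"] by simp
    then have "2 * q \<le> q * q" by simp
    moreover have "8 * jump (x K) \<le> q * q"
      using jump_bound[of "x K" K] assms qq by auto
    ultimately have "4 * height (Suc K) x \<le> q * q"
      using Suc.IH by (simp add: height_Suc q_def[symmetric])
    moreover have "Suc K + 3 = K + 4" by simp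
    ultimately show ?case using qq by metis
  qed
qed

lemma lead_dvd:
  assumes "2 ^ (k + 2) \<le> n"
  shows "16 ^ (2 ^ (k + 3)) dvd lead n j"
proof -
  have "(16::int) ^ (2 ^ (k + 3)) dvd 16 ^ (2 * n)"
    using assms by (intro le_imp_power_dvd) (simp add: power_add)
  then show ?thesis by (simp add: lead_def)
qed

text \<open>Level \<open>K\<close> dominates: its leading parts are divisible by a power of 16 that exceeds the total
  contribution of the lower levels together with the \<open>+1\<close> perturbations, so they cancel on their own.\<close>

lemma height_differences:
  assumes x: "x \<in> addresses" "x' \<in> addresses" "y \<in> addresses" "y' \<in> addresses"
    and ne: "\<And>k. fst (x k) \<noteq> fst (x' k)"
    and eq: "height K y - height K x = height K y' - height K x'"
  shows "height K y = height K x"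
  using eq
proof (induction K)
  case 0
  then show ?case by (simp add: height_def)
next
  case (Suc K)
  have dg: "x K \<in> digits K" "x' K \<in> digits K" "y K \<in> digits K" "y' K \<in> digits K" using x by auto
  obtain u i where u: "x K = (u, i)" "2 ^ (K + 2) \<le> u" "i < 3" using dg(1) by (rule digitsE)
  obtain u' i' where u': "x' K = (u', i')" "2 ^ (K + 2) \<le> u'" "i' < 3" using dg(2) by (rule digitsE)
  obtain v j where v: "y K = (v, j)" "2 ^ (K + 2) \<le> v" "j < 3" using dg(3) by (rule digitsE)
  obtain v' j' where v': "y' K = (v', j')" "2 ^ (K + 2) \<le> v'" "j' < 3" using dg(4) by (rule digitsE)
  define q :: int where "q = 16 ^ (2 ^ (K + 3))"
  define F where "F = lead v j + lead u' i' - (lead u i + lead v' j')"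
  have q: "16 \<le> q" unfolding q_def using power_increasing[of 1 "2 ^ (K + 3)" "16::int"] by simp
  have "q dvd F"
    unfolding F_def q_def using u u' v v' by (intro dvd_diff dvd_add lead_dvd)
  \<comment> \<open>The four heights lie between 0 and a quarter of \<open>q\<close>, so their
    alternating sum is at most half of \<open>q\<close> in absolute value. The perturbations
    contribute at most 2, and \<open>16 \<le> q\<close> leaves room for them.\<close>
  moreover have "\<bar>F\<bar> < q"
    using Suc.prems height_bound[OF x(1), of K] height_bound[OF x(2), of K]
      height_bound[OF x(3), of K] height_bound[OF x(4), of K] q
    unfolding height_Suc u v u' v' jump_eq F_def q_def[symmetric]
    by (auto split: if_splits)
  ultimately have "F = 0" using dvd_imp_le_int by force
  moreover have "u \<noteq> u'" using ne[of K] u u' by simp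
  ultimately have *: "v = u \<and> j = i \<and> v' = u' \<and> j' = i'"
    using u u' v v' by (intro lead_sidon) (auto simp: F_def)
  then have "height K y = height K x" 
    using Suc.prems u u' v v' by (intro Suc.IH) (simp add: height_Suc)
  then show ?case using * u v by (simp add: height_Suc)
qed

section \<open>Return times under finite changes of digits\<close>

text \<open>Beyond level \<open>K\<close> the digits of \<open>x\<close> are copied into the
  witness, which adds the same jumps to both sides. Hence memberships in different sets
  \<open>occ\<close> can be compared at one common level.\<close>

lemma occ_height_mono:
  assumes "x \<in> addresses" "y \<in> addresses" "n + height K x = height K y" "K \<le> L"
  shows "\<exists>z\<in>addresses. n + height L x = height L z"
proof -
  define z where "z k = (if k < K then y k else x k)" for k
  have "height K z = height K y" by (simp add: height_def z_def)
  moreover have "(\<Sum>k=K..<L. jump (z k)) = (\<Sum>k=K..<L. jump (x k))"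
    by (rule sum.cong) (auto simp: z_def)
  ultimately have "n + height L x = height L z" using assms(3) height_split[OF assms(4)] by simp
  moreover have "z \<in> addresses" using assms by (auto simp: z_def Pi_iff)
  ultimately show ?thesis by blast
qed

lemma zero_in_occ: "x \<in> addresses \<Longrightarrow> 0 \<in> occ x"
  by (auto simp: occ_def)

text \<open>After lifting both witnesses to level \<open>max K K'\<close>, \<open>n\<close> is a
  height difference for both addresses at once, and \<open>height_differences\<close> makes it
  vanish.\<close>

lemma occ_disjoint:
  assumes x: "x \<in> addresses" "x' \<in> addresses" and ne: "\<And>k. fst (x k) \<noteq> fst (x' k)"
  shows "occ x \<inter> occ x' = {0}"
proof -
  have "n = 0" if n: "n \<in> occ x" "n \<in> occ x'" for n
  proof -
    obtain K y where y: "y \<in> addresses" "n + height K x = height K y"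
      using n(1) by (auto simp: occ_def)
    obtain K' y' where y': "y' \<in> addresses" "n + height K' x' = height K' y'"
      using n(2) by (auto simp: occ_def)
    obtain z where z: "z \<in> addresses" "n + height (max K K') x = height (max K K') z"
      using occ_height_mono[OF x(1) y max.cobounded1] by blast
    obtain z' where z': "z' \<in> addresses" "n + height (max K K') x' = height (max K K') z'"
      using occ_height_mono[OF x(2) y' max.cobounded2] by blast
    show ?thesis
      using height_differences[OF x z(1) z'(1) ne, of "max K K'"] z(2) z'(2) by simp
  qed
  then show ?thesis using zero_in_occ x by blast
qed

text \<open>From level \<open>K\<close> on the two addresses gain equal jumps, so their heights
  differ by a constant, and this constant translates the set of return times.\<close>

lemma occ_change:
  assumes x: "x \<in> addresses" "y \<in> addresses" and eq: "\<And>k. K \<le> k \<Longrightarrow> x k = y k"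
  shows "n \<in> occ y \<longleftrightarrow> n + (height K y - height K x) \<in> occ x"
proof -
  have diff: "height L y = height L x + (height K y - height K x)" if "K \<le> L" for L
  proof -
    have "(\<Sum>k=K..<L. jump (y k)) = (\<Sum>k=K..<L. jump (x k))"
      by (rule sum.cong) (auto simp: eq)
    then show ?thesis using height_split[OF that, of x] height_split[OF that, of y] by simp
  qed
  have ev: "m \<in> occ u \<longleftrightarrow> (\<exists>L\<ge>K. \<exists>z\<in>addresses. m + height L u = height L z)" 
    if "u \<in> addresses" for m u
  proof
    assume "m \<in> occ u"
    then obtain J z where "z \<in> addresses" "m + height J u = height J z"
      by (auto simp: occ_def)
    from occ_height_mono[OF that this max.cobounded1, of K]
    show "\<exists>L\<ge>K. \<exists>z\<in>addresses. m + height L u = height L z"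
      using max.cobounded2 by blast
  qed (auto simp: occ_def)
  have "n + height L y = height L z \<longleftrightarrow> n + (height K y - height K x) + height L x = height L z"
    if "K \<le> L" for L z
    using diff[OF that] by linarith
  then show ?thesis unfolding ev[OF x(1)] ev[OF x(2)] by blast
qed

lemma occ_common:
  assumes x: "x \<in> addresses" "x' \<in> addresses" and eq: "x 0 = x' 0"
  shows "\<exists>n. n \<noteq> 0 \<and> n \<in> occ x \<inter> occ x'"
proof -
  obtain u i where u: "x 0 = (u, i)" "2 ^ (0 + 2) \<le> u" "u < 2 ^ (0 + 3)" "i < 3"
    using x(1) digitsE[of "x 0" 0] by (metis PiE UNIV_I)
  \<comment> \<open>Another digit with the same first component. The jump difference depends on the
    digit at 0 alone, so it is a return time of every address that starts with
    \<open>x 0\<close>.\<close>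
  define v where "v = (u, if i = 0 then 1 else 0 :: nat)"
  have v: "v \<in> digits 0" using u by (auto simp: v_def digits_def)
  define n where "n = jump v - jump (x 0)"
  have "0 < (16::int) ^ (2 * u)" by simp
  then have "n \<noteq> 0" using u by (auto simp: n_def v_def jump_def simp del: zero_less_power)
  have "n \<in> occ z" if "z \<in> addresses" "z 0 = x 0" for z
    unfolding occ_def
  proof (intro CollectI exI bexI)
    show "n + height 1 z = height 1 (z(0 := v))" using that by (simp add: n_def height_def)
    show "z(0 := v) \<in> addresses" using that v by (auto simp: Pi_iff)
  qed
  with \<open>n \<noteq> 0\<close> show ?thesis using x eq by auto
qed

section \<open>Product measures\<close>

text \<open>Induction over the generated sigma-algebra. For a disjoint union the tail
  \<open>R m\<close> is cut off; since \<open>f K\<close> preserves the measure, the tail and its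
  preimage cost at most \<open>2 * prob (R m)\<close>, uniformly in \<open>K\<close>, and finitely
  many sets remain.\<close>

lemma (in prob_space) asymptotically_invariant:
  assumes G: "Int_stable G" "G \<subseteq> Pow (space M)" "sets M = sigma_sets (space M) G"
    and f[measurable]: "\<And>K::nat. f K \<in> measurable M M"
    and pres: "\<And>K. distr M M (f K) = M"
    and ev: "\<And>A. A \<in> G \<Longrightarrow> \<forall>\<^sub>F K in sequentially. \<forall>x\<in>space M. f K x \<in> A \<longleftrightarrow> x \<in> A"
    and E: "E \<in> sets M"
  shows "(\<lambda>K. prob {x \<in> space M. (f K x \<in> E) \<noteq> (x \<in> E)}) \<longlonglongrightarrow> 0"
  using E[unfolded G(3)]
proof (induction E rule: sigma_sets_induct_disjoint[OF G(1,2), consumes 1, case_names basic empty compl union])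
  case (basic A)
  have "\<forall>\<^sub>F K in sequentially. prob {x \<in> space M. (f K x \<in> A) \<noteq> (x \<in> A)} = 0"
    using ev[OF basic] by eventually_elim (auto intro: arg_cong[where f = prob, of _ "{}", simplified])
  then show ?case by (simp add: tendsto_eventually)
next
  case empty
  show ?case by simp
next
  case (compl A)
  have "{x \<in> space M. (f K x \<in> space M - A) \<noteq> (x \<in> space M - A)}
      = {x \<in> space M. (f K x \<in> A) \<noteq> (x \<in> A)}" for K
    using measurable_space[OF f] by auto
  then show ?case using compl by simp
next
  case (union A)
  have A[measurable]: "A i \<in> sets M" for i using union(2) G(3) by auto
  define R where "R m = (\<Union>i. A i) - (\<Union>i<m. A i)" for m
  have R[measurable]: "R m \<in> sets M" for m unfolding R_def by measurable
  have "(\<lambda>m. prob (R m)) \<longlonglongrightarrow> prob (\<Inter>m. R m)"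
    by (intro finite_Lim_measure_decseq) (auto simp: R_def decseq_def)
  moreover have "(\<Inter>m. R m) = {}" by (auto simp: R_def)
  ultimately have Rlim: "(\<lambda>m. prob (R m)) \<longlonglongrightarrow> 0" by simp
  have bound: "prob {x \<in> space M. (f K x \<in> (\<Union>i. A i)) \<noteq> (x \<in> (\<Union>i. A i))}
      \<le> (\<Sum>i<m. prob {x \<in> space M. (f K x \<in> A i) \<noteq> (x \<in> A i)}) + 2 * prob (R m)" for K m
  proof -
    let ?D = "\<lambda>i. {x \<in> space M. (f K x \<in> A i) \<noteq> (x \<in> A i)}"
    have "prob {x \<in> space M. (f K x \<in> (\<Union>i. A i)) \<noteq> (x \<in> (\<Union>i. A i))}
        \<le> prob ((\<Union>i<m. ?D i) \<union> (R m \<union> (f K -` R m \<inter> space M)))"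
      by (intro finite_measure_mono) (auto simp: R_def dest: measurable_space[OF f])
    also have "\<dots> \<le> prob (\<Union>i<m. ?D i) + prob (R m \<union> (f K -` R m \<inter> space M))"
      by (intro measure_Un_le) auto
    also have "\<dots> \<le> prob (\<Union>i<m. ?D i) + (prob (R m) + prob (f K -` R m \<inter> space M))"
      by (intro add_left_mono measure_Un_le) auto
    also have "prob (f K -` R m \<inter> space M) = prob (R m)"
      using measure_distr[OF f R, of K m] pres[of K] by simp
    also have "prob (\<Union>i<m. ?D i) \<le> (\<Sum>i<m. prob (?D i))"
      by (intro measure_UNION_le) auto
    finally show ?thesis by simp
  qed
  show ?case
  proof (rule LIMSEQ_I)
    fix e :: real assume e: "0 < e"
    obtain m where m: "prob (R m) < e / 4"
      using LIMSEQ_D[OF Rlim, of "e / 4"] e by auto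
    have "(\<lambda>K. \<Sum>i<m. prob {x \<in> space M. (f K x \<in> A i) \<noteq> (x \<in> A i)}) \<longlonglongrightarrow> (\<Sum>i<m. 0)"
      by (intro tendsto_sum union)
    then obtain K0 where "\<And>K. K \<ge> K0 \<Longrightarrow>
        \<bar>\<Sum>i<m. prob {x \<in> space M. (f K x \<in> A i) \<noteq> (x \<in> A i)}\<bar> < e / 2"
      using LIMSEQ_D[of _ _ "e / 2"] e by fastforce
    then have "norm (prob {x \<in> space M. (f K x \<in> (\<Union>i. A i)) \<noteq> (x \<in> (\<Union>i. A i))} - 0) < e"
      if "K \<ge> K0" for K
      using bound[of K m] m that by (fastforce simp: abs_less_iff)
    then show "\<exists>no. \<forall>K\<ge>no. norm (prob {x \<in> space M. (f K x \<in> (\<Union>i. A i)) \<noteq> (x \<in> (\<Union>i. A i))} - 0) < e"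
      by blast
  qed
qed

context product_prob_space
begin

lemma distr_PiM_fun_upd:
  assumes k: "k \<in> I" and r[measurable]: "r \<in> measurable (M k) (M k)" and pres: "distr (M k) (M k) r = M k"
  shows "distr (PiM I M) (PiM I M) (\<lambda>x. x(k := r (x k))) = PiM I M"
    and "(\<lambda>x. x(k := r (x k))) \<in> measurable (PiM I M) (PiM I M)"
proof -
  have Ik: "insert k I = I" using k by blast
  have "(\<lambda>x. x(k := r (x k))) \<in> measurable (PiM I M) (PiM (insert k I) M)"
    using k by (intro measurable_fun_upd[where J = I]) auto
  then show m[measurable]: "(\<lambda>x. x(k := r (x k))) \<in> measurable (PiM I M) (PiM I M)"
    by (simp add: Ik)
  show "distr (PiM I M) (PiM I M) (\<lambda>x. x(k := r (x k))) = PiM I M"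
  proof (rule PiM_eq)
    fix J F assume J: "finite J" "J \<subseteq> I" and F: "\<And>j. j \<in> J \<Longrightarrow> F j \<in> sets (M j)"
    define F' where "F' j = (if j = k then r -` F k \<inter> space (M k) else F j)" for j
    have F': "F' j \<in> sets (M j)" if "j \<in> J" for j
      using F[OF that] by (auto simp: F'_def)
    have "emeasure (distr (PiM I M) (PiM I M) (\<lambda>x. x(k := r (x k)))) (emb I J (Pi\<^sub>E J F))
        = emeasure (PiM I M) ((\<lambda>x. x(k := r (x k))) -` emb I J (Pi\<^sub>E J F) \<inter> space (PiM I M))"
      using J F by (intro emeasure_distr) (auto intro!: sets_PiM_I)
    also have "(\<lambda>x. x(k := r (x k))) -` emb I J (Pi\<^sub>E J F) \<inter> space (PiM I M) = emb I J (Pi\<^sub>E J F')"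
      using measurable_space[OF m] J k measurable_space[OF r]
      by (fastforce simp: prod_emb_def F'_def space_PiM PiE_iff extensional_def split: if_splits)
    also have "emeasure (PiM I M) \<dots> = (\<Prod>j\<in>J. emeasure (M j) (F' j))"
      using J F' by (intro emeasure_PiM_emb) auto
    also have "\<dots> = (\<Prod>j\<in>J. emeasure (M j) (F j))"
    proof (rule prod.cong)
      fix j assume j: "j \<in> J"
      show "emeasure (M j) (F' j) = emeasure (M j) (F j)"
      proof (cases "j = k")
        case True
        then show ?thesis using emeasure_distr[OF r F[OF j, unfolded True]] pres by (simp add: F'_def)
      qed (simp add: F'_def)
    qed simp
    finally show "emeasure (distr (PiM I M) (PiM I M) (\<lambda>x. x(k := r (x k)))) (emb I J (Pi\<^sub>E J F)) 
      = (\<Prod>j\<in>J. emeasure (M j) (F j))" .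
  qed simp
qed

section \<open>Resampling coordinates and a zero-one law\<close>

definition splice :: "'i set \<Rightarrow> ('i \<Rightarrow> 'a) \<times> ('i \<Rightarrow> 'a) \<Rightarrow> 'i \<Rightarrow> 'a" where
  "splice J z = (\<lambda>i\<in>I. if i \<in> J then snd z i else fst z i)"

lemma measurable_splice[measurable]: "splice J \<in> measurable (PiM I M \<Otimes>\<^sub>M PiM I M) (PiM I M)"
  unfolding splice_def
proof (rule measurable_restrict)
  fix i assume "i \<in> I"
  then show "(\<lambda>z. if i \<in> J then snd z i else fst z i) \<in> measurable (PiM I M \<Otimes>\<^sub>M PiM I M) (M i)"
    by (cases "i \<in> J") (auto intro: measurable_compose[OF _ measurable_component_singleton])
qed

text \<open>A cylinder pulls back to a rectangle whose sides carry the conditions outside and inside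
  \<open>J\<close>; the product over the coordinates splits accordingly.\<close>

lemma distr_splice: "distr (PiM I M \<Otimes>\<^sub>M PiM I M) (PiM I M) (splice J) = PiM I M"
proof (rule PiM_eq)
  fix L F assume L: "finite L" "L \<subseteq> I" and F: "\<And>j. j \<in> L \<Longrightarrow> F j \<in> sets (M j)"
  have "emeasure (distr (PiM I M \<Otimes>\<^sub>M PiM I M) (PiM I M) (splice J)) (emb I L (Pi\<^sub>E L F))
      = emeasure (PiM I M \<Otimes>\<^sub>M PiM I M) (splice J -` emb I L (Pi\<^sub>E L F) \<inter> space (PiM I M \<Otimes>\<^sub>M PiM I M))"
    using L F by (intro emeasure_distr) (auto intro!: sets_PiM_I)
  also have "splice J -` emb I L (Pi\<^sub>E L F) \<inter> space (PiM I M \<Otimes>\<^sub>M PiM I M)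
      = emb I (L - J) (Pi\<^sub>E (L - J) F) \<times> emb I (L \<inter> J) (Pi\<^sub>E (L \<inter> J) F)"
    using L by (auto simp: prod_emb_def splice_def space_pair_measure space_PiM PiE_iff subset_eq extensional_def split: if_splits)
  also have "emeasure (PiM I M \<Otimes>\<^sub>M PiM I M) \<dots>
      = emeasure (PiM I M) (emb I (L - J) (Pi\<^sub>E (L - J) F)) * emeasure (PiM I M) (emb I (L \<inter> J) (Pi\<^sub>E (L \<inter> J) F))"
    using L F by (intro P.emeasure_pair_measure_Times sets_PiM_I) auto
  also have "\<dots> = (\<Prod>j\<in>L - J. emeasure (M j) (F j)) * (\<Prod>j\<in>L \<inter> J. emeasure (M j) (F j))"
    using L F by (subst (1 2) emeasure_PiM_emb) auto
  also have "\<dots> = (\<Prod>j\<in>L. emeasure (M j) (F j))"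
    using L by (subst prod.union_disjoint[symmetric]) (auto intro: prod.cong)
  finally show "emeasure (distr (PiM I M \<Otimes>\<^sub>M PiM I M) (PiM I M) (splice J)) (emb I L (Pi\<^sub>E L F))
      = (\<Prod>j\<in>L. emeasure (M j) (F j))" .
qed simp

text \<open>Resampling the coordinates that a cylinder reads shows that \<open>E\<close> is
  independent of every cylinder. If \<open>E\<close> is not null, the measure conditioned on
  \<open>E\<close> therefore agrees with the product measure, and evaluating both at
  \<open>E\<close> gives 1.\<close>

lemma zero_one_splice:
  assumes E[measurable]: "E \<in> sets (PiM I M)"
    and inv: "\<And>J. finite J \<Longrightarrow> AE z in PiM I M \<Otimes>\<^sub>M PiM I M. splice J z \<in> E \<longleftrightarrow> fst z \<in> E"
  shows "P.prob E = 0 \<or> P.prob E = 1"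
proof (cases "emeasure (PiM I M) E = 0")
  case True
  then show ?thesis by (simp add: measure_def)
next
  case False
  have "uniform_measure (PiM I M) E = PiM I M"
  proof (rule PiM_eq)
    fix J F assume J: "finite J" "J \<subseteq> I" and F: "\<And>j. j \<in> J \<Longrightarrow> F j \<in> sets (M j)"
    define X where "X = emb I J (Pi\<^sub>E J F)"
    have X[measurable]: "X \<in> sets (PiM I M)" unfolding X_def using J F by (intro sets_PiM_I) auto
    have X_splice: "splice J z \<in> X \<longleftrightarrow> snd z \<in> X" if "z \<in> space (PiM I M \<Otimes>\<^sub>M PiM I M)" for z
      using that measurable_space[OF measurable_splice that, of J] J
      by (auto simp: X_def prod_emb_def space_pair_measure space_PiM splice_def PiE_iff subset_eq)
    have "emeasure (PiM I M) (E \<inter> X) = emeasure (distr (PiM I M \<Otimes>\<^sub>M PiM I M) (PiM I M) (splice J)) (E \<inter> X)"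
      by (simp add: distr_splice)
    also have "\<dots> = emeasure (PiM I M \<Otimes>\<^sub>M PiM I M) (splice J -` (E \<inter> X) \<inter> space (PiM I M \<Otimes>\<^sub>M PiM I M))"
      by (intro emeasure_distr) auto
    also have "\<dots> = emeasure (PiM I M \<Otimes>\<^sub>M PiM I M) (E \<times> X)"
    proof (rule emeasure_eq_AE)
      show "AE z in PiM I M \<Otimes>\<^sub>M PiM I M.
          z \<in> splice J -` (E \<inter> X) \<inter> space (PiM I M \<Otimes>\<^sub>M PiM I M) \<longleftrightarrow> z \<in> E \<times> X"
        using inv[OF J(1)] AE_space by eventually_elim (auto simp: X_splice mem_Times_iff)
    qed (auto intro: measurable_sets[OF measurable_splice])
    also have "\<dots> = emeasure (PiM I M) E * emeasure (PiM I M) X"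
      by (intro P.emeasure_pair_measure_Times) auto
    also have "emeasure (PiM I M) X = (\<Prod>j\<in>J. emeasure (M j) (F j))"
      unfolding X_def using J F by (intro emeasure_PiM_emb) auto
    finally have "emeasure (PiM I M) (E \<inter> X) = emeasure (PiM I M) E * (\<Prod>j\<in>J. emeasure (M j) (F j))" .
    then show "emeasure (uniform_measure (PiM I M) E) (emb I J (Pi\<^sub>E J F)) = (\<Prod>j\<in>J. emeasure (M j) (F j))"
      using False P.emeasure_finite[of E] X
      by (simp add: X_def[symmetric] mult.commute[of "emeasure _ E"] ennreal_mult_divide_eq)
  qed simp
  then have "emeasure (PiM I M) E = emeasure (uniform_measure (PiM I M) E) E" by simp
  also have "\<dots> = 1"
    using False P.emeasure_finite[of E]
    by (simp add: ennreal_divide_self less_top[symmetric] del: P.emeasure_finite)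
  finally show ?thesis by (simp add: measure_def)
qed

end

section \<open>Random addresses\<close>

lemma finite_digits: "finite (digits k)" and digits_nonempty: "digits k \<noteq> {}"
  by (auto simp: digits_def power_add lessThan_empty_iff)

lemma card_digits: "card (digits k) = 3 * 2 ^ (k + 2)"
  by (simp add: digits_def card_cartesian_product power_add)

abbreviation addr :: "(nat \<Rightarrow> nat \<times> nat) measure" where
  "addr \<equiv> PiM UNIV (\<lambda>k. uniform_count_measure (digits k))"

interpretation addr: product_prob_space "\<lambda>k. uniform_count_measure (digits k)" UNIV
  by (intro product_prob_spaceI prob_space_uniform_count_measure finite_digits digits_nonempty)

lemma space_addr: "space addr = addresses"
  by (simp add: space_PiM PiE_UNIV_domain space_uniform_count_measure)

lemma distr_uniform_count_measure_bij:
  assumes "finite A" "bij_betw r A A"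
  shows "distr (uniform_count_measure A) (uniform_count_measure A) r = uniform_count_measure A"
proof (rule measure_eqI)
  have r: "r \<in> measurable (uniform_count_measure A) (uniform_count_measure A)"
    using assms(2) by (auto simp: measurable_def space_uniform_count_measure sets_uniform_count_measure bij_betw_def)
  fix X assume "X \<in> sets (distr (uniform_count_measure A) (uniform_count_measure A) r)"
  then have X: "X \<subseteq> A" by (simp add: sets_uniform_count_measure)
  have "inj_on r (r -` X \<inter> A)" "r ` (r -` X \<inter> A) = X"
    using assms X by (auto simp: bij_betw_def inj_on_def) (blast elim: equalityE)
  then have "card (r -` X \<inter> A) = card X" using card_image by metis
  then show "emeasure (distr (uniform_count_measure A) (uniform_count_measure A) r) X
      = emeasure (uniform_count_measure A) X"
    using assms X
    by (simp add: emeasure_distr[OF r] sets_uniform_count_measure space_uniform_count_measure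
        emeasure_uniform_count_measure)
qed simp

section \<open>Rotating one digit\<close>

definition rotate_digit :: "nat \<times> nat \<Rightarrow> nat \<times> nat" where
  "rotate_digit v = (fst v, (snd v + 1) mod 3)"

lemma bij_rotate_digit: "bij_betw rotate_digit (digits k) (digits k)"
proof (rule bij_betw_byWitness)
  show "\<forall>v\<in>digits k. (fst (rotate_digit v), (snd (rotate_digit v) + 2) mod 3) = v"
    by (auto simp: rotate_digit_def digits_def mod_simps)
  show "\<forall>v\<in>digits k. rotate_digit (fst v, (snd v + 2) mod 3) = v"
    by (auto simp: rotate_digit_def digits_def mod_simps)
qed (auto simp: rotate_digit_def digits_def)

definition rot :: "nat \<Rightarrow> (nat \<Rightarrow> nat \<times> nat) \<Rightarrow> nat \<Rightarrow> nat \<times> nat" where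
  "rot K x = x(K := rotate_digit (x K))"

lemma measurable_rot[measurable]: "rot K \<in> measurable addr addr"
  and distr_rot: "distr addr addr (rot K) = addr"
proof -
  have "rotate_digit \<in> measurable (uniform_count_measure (digits K)) (uniform_count_measure (digits K))"
    using bij_rotate_digit[of K]
    by (auto simp: measurable_def space_uniform_count_measure sets_uniform_count_measure bij_betw_def)
  then show "rot K \<in> measurable addr addr" "distr addr addr (rot K) = addr"
    using addr.distr_PiM_fun_upd[of K rotate_digit]
      distr_uniform_count_measure_bij[OF finite_digits bij_rotate_digit, of K]
    by (simp_all add: rot_def[abs_def])
qed

text \<open>A cylinder over \<open>J\<close> does not notice the rotation of a digit outside
  \<open>J\<close>, which gives eventual invariance on the generator
  \<open>prod_algebra\<close>.\<close>

lemma rot_asymptotically_invariant: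
  assumes "E \<in> sets addr"
  shows "(\<lambda>K. addr.P.prob {x \<in> space addr. (rot K x \<in> E) \<noteq> (x \<in> E)}) \<longlonglongrightarrow> 0"
proof (rule addr.P.asymptotically_invariant[OF Int_stable_prod_algebra _ _ measurable_rot distr_rot _ assms])
  show "sets addr = sigma_sets (space addr) (prod_algebra UNIV (\<lambda>k. uniform_count_measure (digits k)))"
    by (simp add: sets_PiM space_PiM)
  show "prod_algebra UNIV (\<lambda>k. uniform_count_measure (digits k)) \<subseteq> Pow (space addr)"
    using prod_algebra_sets_into_space by (simp add: space_PiM)
  fix A assume "A \<in> prod_algebra UNIV (\<lambda>k. uniform_count_measure (digits k))"
  then obtain J F where J: "finite J" "A = addr.emb UNIV J (Pi\<^sub>E J F)"
    by (rule prod_algebraE) blast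
  have "rot K x \<in> A \<longleftrightarrow> x \<in> A" if "x \<in> space addr" "K \<notin> J" for K x
    using that measurable_space[OF measurable_rot that(1), of K] J(2)
    by (auto simp: prod_emb_def space_PiM rot_def PiE_iff restrict_def fun_eq_iff extensional_def)
  moreover have "\<forall>\<^sub>F K in sequentially. K \<notin> J"
    using J(1) finite_nat_iff_bounded by (auto simp: eventually_sequentially) (meson lessThan_iff not_le subsetD)
  ultimately show "\<forall>\<^sub>F K in sequentially. \<forall>x\<in>space addr. rot K x \<in> A \<longleftrightarrow> x \<in> A"
    by (auto elim: eventually_mono)
qed

text \<open>For suitable \<open>K\<close> the set \<open>D K\<close>, where the rotation changes
  membership, has less than half the measure of \<open>E\<close>. Together with its preimage under
  the rotation it cannot cover \<open>E\<close>, and a point left over keeps its whole rotation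
  orbit of length 3 in \<open>E\<close>.\<close>

lemma full_fibre:
  assumes E[measurable]: "E \<in> sets addr" and pos: "addr.P.prob E > 0"
  shows "\<exists>K x n. \<forall>j<3. x(K := (n, j)) \<in> E"
proof -
  define D where "D K = {x \<in> space addr. (rot K x \<in> E) \<noteq> (x \<in> E)}" for K
  have D[measurable]: "D K \<in> sets addr" for K unfolding D_def by measurable
  obtain K where K: "addr.P.prob (D K) < addr.P.prob E / 2"
    using LIMSEQ_D[OF rot_asymptotically_invariant[OF E], of "addr.P.prob E / 2"] pos
    by (auto simp: D_def)
  have "addr.P.prob (D K \<union> (rot K -` D K \<inter> space addr)) \<le> addr.P.prob (D K) + addr.P.prob (rot K -` D K \<inter> space addr)"
    by (intro measure_Un_le) auto
  also have "addr.P.prob (rot K -` D K \<inter> space addr) = addr.P.prob (D K)"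
    using measure_distr[OF measurable_rot D, of K K] by (simp add: distr_rot)
  finally have "addr.P.prob (D K \<union> (rot K -` D K \<inter> space addr)) < addr.P.prob E" using K by simp
  then have "\<not> E \<subseteq> D K \<union> (rot K -` D K \<inter> space addr)"
    using addr.P.finite_measure_mono[of E "D K \<union> (rot K -` D K \<inter> space addr)"] by fastforce
  then obtain x where x: "x \<in> E" "x \<notin> D K" "rot K x \<notin> D K" "x \<in> space addr"
    using sets.sets_into_space[OF E] by auto
  have x1: "rot K x \<in> E" using x by (auto simp: D_def)
  have x2: "rot K (rot K x) \<in> E"
    using x x1 measurable_space[OF measurable_rot, of x K] by (auto simp: D_def)
  obtain n j where nj: "x K = (n, j)" "j < 3"
    using x(4) digitsE[of "x K" K] unfolding space_addr by (metis PiE UNIV_I)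
  have "x(K := (n, j)) \<in> E" using x(1) nj by (simp add: fun_upd_idem)
  moreover have "x(K := (n, (j + 1) mod 3)) \<in> E" using x1 nj by (simp add: rot_def rotate_digit_def)
  moreover have "x(K := (n, (j + 2) mod 3)) \<in> E" using x2 nj by (simp add: rot_def rotate_digit_def mod_simps)
  moreover have "i = j \<or> i = (j + 1) mod 3 \<or> i = (j + 2) mod 3" if "i < 3" for i
    using that nj(2) by (simp add: mod_if) linarith
  ultimately have "x(K := (n, i)) \<in> E" if "i < 3" for i using that by metis
  then show ?thesis by blast
qed

section \<open>Measurability of the coding\<close>

lemma measurable_height[measurable]: "(\<lambda>x. real_of_int (height K x)) \<in> borel_measurable addr"
proof -
  have "(\<lambda>x. real_of_int (jump (x k))) \<in> borel_measurable addr" for k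
  proof (rule measurable_compose[OF measurable_component_singleton])
    show "(\<lambda>v. real_of_int (jump v)) \<in> borel_measurable (uniform_count_measure (digits k))"
      by (simp add: measurable_def sets_uniform_count_measure space_uniform_count_measure)
  qed simp
  then show ?thesis unfolding height_def of_int_sum by (intro borel_measurable_sum)
qed

lemma measurable_occ[measurable]: "Measurable.pred addr (\<lambda>x. n \<in> occ x)"
proof -
  \<comment> \<open>The uncountably many \<open>y\<close> enter only through an integer height, so a
    countable union over \<open>K\<close> and the elements of \<open>Q K\<close> remains.\<close>
  define Q where "Q K = height K ` addresses" for K
  have "n \<in> occ x \<longleftrightarrow> (\<exists>K. \<exists>m\<in>Q K. real_of_int (height K x) = real_of_int (m - n))" for x
  proof
    assume "n \<in> occ x"
    then obtain K y where "y \<in> addresses" "n + height K x = height K y" by (auto simp: occ_def)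
    then have "height K y \<in> Q K" "real_of_int (height K x) = real_of_int (height K y - n)"
      by (auto simp: Q_def)
    then show "\<exists>K. \<exists>m\<in>Q K. real_of_int (height K x) = real_of_int (m - n)" by blast
  next
    assume "\<exists>K. \<exists>m\<in>Q K. real_of_int (height K x) = real_of_int (m - n)"
    then obtain K y where "y \<in> addresses" "height K x = height K y - n"
      unfolding of_int_eq_iff Q_def by blast
    then have "n + height K x = height K y" by simp
    with \<open>y \<in> addresses\<close> show "n \<in> occ x" unfolding occ_def by blast
  qed
  moreover have "Measurable.pred addr (\<lambda>x. \<exists>K. \<exists>m. m \<in> Q K \<and> real_of_int (height K x) = real_of_int (m - n))"
    by measurable
  ultimately show ?thesis by (simp add: Bex_def)
qed

definition shift :: "int \<Rightarrow> (int \<Rightarrow> real) \<Rightarrow> int \<Rightarrow> real" where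
  "shift m w = (\<lambda>i. w (i + m))"

definition code :: "(nat \<Rightarrow> nat \<times> nat) \<Rightarrow> int \<Rightarrow> real" where
  "code x = indicat_real (occ x)"

lemma shift_shift: "shift m (shift n w) = shift (m + n) w"
  by (simp add: shift_def add.assoc)

lemma shift_0[simp]: "shift 0 w = w"
  by (simp add: shift_def)

lemma measurable_shift[measurable]: "shift m \<in> borel_measurable borel"
  unfolding shift_def by (intro measurable_coordinatewise_then_product) measurable

lemma measurable_code[measurable]: "code \<in> borel_measurable addr"
  unfolding code_def indicator_def by (intro measurable_coordinatewise_then_product) measurable

lemma code_change:
  assumes "x \<in> addresses" "y \<in> addresses" "\<And>k. K \<le> k \<Longrightarrow> x k = y k"
  shows "code y = shift (height K y - height K x) (code x)"
  using occ_change[OF assms] by (auto simp: code_def shift_def indicator_def)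

text \<open>Only an injection is needed: the Borel structure on the reals plays no role, the one of
  \<open>int \<Rightarrow> real\<close> is transported.\<close>

definition to_real :: "(int \<Rightarrow> real) \<Rightarrow> real" where
  "to_real = (SOME h. inj h)"

text \<open>A sequence of reals becomes a sequence of sets of naturals, and the pairs of index and
  element form a single set of naturals, hence a real. This makes the choice in
  \<open>to_real\<close> meaningful.\<close>

lemma inj_to_real: "inj to_real"
proof -
  obtain g :: "real \<Rightarrow> nat set" where g: "inj g"
    using eqpoll_imp_lepoll[OF eqpoll_sym[OF nat_sets_eqpoll_reals]] by (auto simp: lepoll_def)
  obtain h :: "nat set \<Rightarrow> real" where h: "inj h"
    using eqpoll_imp_lepoll[OF nat_sets_eqpoll_reals] by (auto simp: lepoll_def)
  define f :: "(int \<Rightarrow> real) \<Rightarrow> nat set" where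
    "f w = {prod_encode (int_encode i, m) | i m. m \<in> g (w i)}" for w
  have "inj f"
  proof (rule injI)
    fix w w' assume eq: "f w = f w'"
    have "m \<in> g (w i) \<longleftrightarrow> prod_encode (int_encode i, m) \<in> f w" for m i w
      by (auto simp: f_def prod_encode_eq int_encode_eq)
    then have "g (w i) = g (w' i)" for i using eq by blast
    then show "w = w'" using injD[OF g] by blast
  qed
  then have "inj (h \<circ> f)" using h by (rule inj_compose[rotated])
  then show ?thesis unfolding to_real_def by (rule someI[where P = "\<lambda>h. inj h"])
qed

text \<open>Pulling the topology back along \<open>inv h\<close> makes \<open>h\<close> a
  homeomorphism onto its range, so second countability and complete metrizability carry over, and
  the Borel sets of the range are the images of Borel sets.\<close>

lemma standard_borel_embed_measure:
  fixes h :: "'a :: polish_space \<Rightarrow> 'b"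
  assumes h: "inj h" and M: "sets M = sets (embed_measure (borel :: 'a measure) h)"
  shows "standard_borel M"
proof -
  define X where "X = pullback_topology (range h) (inv h) (euclidean :: 'a topology)"
  have open_X: "openin X V \<longleftrightarrow> (\<exists>U. open U \<and> V = h ` U)" for V
  proof -
    have "inv h -` U \<inter> range h = h ` U" for U using h by auto
    then show ?thesis by (simp add: X_def openin_pullback_topology)
  qed
  have top: "topspace X = range h" by (simp add: X_def topspace_pullback_topology)
  have "homeomorphic_map euclidean X h"
    unfolding homeomorphic_eq_everything_map
  proof (intro conjI)
    show "continuous_map euclidean X h"
      by (auto simp: continuous_map top open_X inj_vimage_image_eq[OF h] vimage_def[symmetric])
    show "open_map euclidean X h" by (auto simp: open_map_def open_X)
    then show "closed_map euclidean X h"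
      using h by (intro bijective_open_imp_closed_map) (auto simp: top)
  qed (auto simp: top h)
  then have homeo: "(euclidean :: 'a topology) homeomorphic_space X" 
    using homeomorphic_map_imp_homeomorphic_space by blast
  have "second_countable (euclidean :: 'a topology)"
  proof -
    obtain B :: "'a set set" where "countable B" "topological_basis B" using ex_countable_basis by blast
    moreover have "\<exists>V\<in>B. x \<in> V \<and> V \<subseteq> U" if "open U" "x \<in> U" for U x
      using topological_basisE[OF \<open>topological_basis B\<close> that] by metis
    ultimately show ?thesis
      unfolding second_countable_def using topological_basis_open[of B]
      by (intro exI[of _ B]) simp
  qed
  then have "second_countable X" using homeo homeomorphic_space_second_countability by blast
  moreover have "completely_metrizable_space X"
    using homeo homeomorphic_completely_metrizable_space completely_metrizable_space_euclidean by blast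
  moreover have space: "space M = range h"
    using sets_eq_imp_space_eq[OF M] by (simp add: space_embed_measure)
  moreover have "sets M = sigma_sets (range h) {V. openin X V}"
  proof
    show "sigma_sets (range h) {V. openin X V} \<subseteq> sets M"
      unfolding space[symmetric]
      by (rule sets.sigma_sets_subset) (auto simp: M open_X intro!: in_sets_embed_measure)
    show "sets M \<subseteq> sigma_sets (range h) {V. openin X V}"
    proof
      fix A assume "A \<in> sets M"
      then obtain B where B: "A = h ` B" "B \<in> sets borel"
        by (auto simp: M sets_embed_measure[OF h])
      have "B \<in> sigma_sets UNIV {S. open S}" using B(2) by (simp add: borel_def)
      then show "A \<in> sigma_sets (range h) {V. openin X V}"
        unfolding B(1)
      proof induction
        case (Compl B)
        have "h ` (UNIV - B) = range h - h ` B" using h by (simp add: image_set_diff)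
        with Compl show ?case by (simp add: sigma_sets.Compl)
      next
        case (Union B)
        then show ?case by (simp add: image_UN sigma_sets.Union)
      qed (auto simp: open_X intro: sigma_sets.Empty)
    qed
  qed
  ultimately show ?thesis unfolding standard_borel_def using top by auto
qed

section \<open>The system\<close>

definition weights :: "int pmf" where
  "weights = map_pmf int_decode (geometric_pmf (1 / 2))"

lemma set_pmf_weights: "set_pmf weights = UNIV"
  by (simp add: weights_def set_map_pmf set_pmf_geometric bij_is_surj[OF bij_int_decode])

abbreviation coded_space :: "real measure" where
  "coded_space \<equiv> embed_measure (borel :: (int \<Rightarrow> real) measure) to_real"

definition orb :: "int \<Rightarrow> (nat \<Rightarrow> nat \<times> nat) \<Rightarrow> real" where
  "orb n x = to_real (shift n (code x))"

text \<open>Averaging all translates with positive weights makes the translation nonsingular: a set is null iff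
  each of its translates is null for the law of the base points.\<close>

definition sys_measure :: "real measure" where
  "sys_measure = distr (measure_pmf weights \<Otimes>\<^sub>M addr) coded_space (\<lambda>(n, x). orb n x)"

definition translate :: "int \<Rightarrow> real \<Rightarrow> real" where
  "translate m r = to_real (shift m (inv to_real r))"

lemma inv_to_real[simp]: "inv to_real (to_real w) = w"
  by (simp add: inj_to_real)

lemma translate_to_real[simp]: "translate m (to_real w) = to_real (shift m w)"
  by (simp add: translate_def)

lemma space_coded: "space coded_space = range to_real"
  by (simp add: space_embed_measure)

lemma measurable_to_real[measurable]: "to_real \<in> measurable borel coded_space"
  by (rule measurable_embed_measure2[OF inj_to_real])

lemma measurable_inv_to_real[measurable]: "inv to_real \<in> measurable coded_space borel"
  by (rule measurable_embed_measure1) simp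

lemma measurable_coordinate: "(\<lambda>r. inv to_real r n) \<in> borel_measurable coded_space"
  by (rule measurable_compose[OF measurable_inv_to_real measurable_product_coordinates])

lemma measurable_translate[measurable]: "translate m \<in> measurable coded_space coded_space"
  unfolding translate_def[abs_def] by measurable

lemma measurable_orb[measurable]: "orb n \<in> measurable addr coded_space"
  unfolding orb_def[abs_def] by measurable

lemma orb_in_space: "orb n x \<in> space coded_space"
  by (simp add: orb_def space_coded)

lemma translate_orb: "translate m (orb n x) = orb (m + n) x"
  by (simp add: orb_def shift_shift)

lemma translate_add: "r \<in> space coded_space \<Longrightarrow> translate m (translate n r) = translate (m + n) r"
  by (auto simp: space_coded shift_shift)

lemma translate_0: "r \<in> space coded_space \<Longrightarrow> translate 0 r = r"
  by (auto simp: space_coded)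

lemma measurable_orbits[measurable]: "(\<lambda>(n, x). orb n x) \<in> measurable (measure_pmf weights \<Otimes>\<^sub>M addr) coded_space"
proof -
  have "(\<lambda>(n, x). orb n x) \<in> measurable (count_space UNIV \<Otimes>\<^sub>M addr) coded_space"
    by (rule measurable_pair_measure_countable1) auto
  also have "measurable (count_space UNIV \<Otimes>\<^sub>M addr) coded_space = measurable (measure_pmf weights \<Otimes>\<^sub>M addr) coded_space"
    by (intro measurable_cong_sets sets_pair_measure_cong) auto
  finally show ?thesis .
qed

lemma sets_sys[measurable_cong, simp]: "sets sys_measure = sets coded_space"
  and space_sys[simp]: "space sys_measure = space coded_space"
  by (simp_all add: sys_measure_def)

interpretation weights_addr: pair_prob_space "measure_pmf weights" addr
  by unfold_locales

lemma prob_space_sys: "prob_space sys_measure"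
  unfolding sys_measure_def by (rule weights_addr.prob_space_distr) measurable

interpretation sys: prob_space sys_measure
  by (rule prob_space_sys)

text \<open>Fubini gives the property for almost all \<open>n\<close> with respect to
  \<open>weights\<close>, hence for every \<open>n\<close>, because each integer has positive
  weight.\<close>

lemma AE_sys_imp:
  assumes "AE r in sys_measure. Q r"
  shows "AE x in addr. \<forall>n. Q (orb n x)"
proof -
  have "AE z in measure_pmf weights \<Otimes>\<^sub>M addr. Q (case z of (n, x) \<Rightarrow> orb n x)"
    using assms unfolding sys_measure_def by (rule AE_distrD[rotated]) measurable
  from weights_addr.AE_pair[OF this] show ?thesis
    by (simp add: AE_measure_pmf_iff set_pmf_weights AE_all_countable)
qed

lemma AE_sysI:
  assumes Q: "{r \<in> space coded_space. Q r} \<in> sets coded_space" and ae: "\<And>n. AE x in addr. Q (orb n x)"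
  shows "AE r in sys_measure. Q r"
proof -
  have "AE z in measure_pmf weights \<Otimes>\<^sub>M addr. Q (case z of (n, x) \<Rightarrow> orb n x)"
  proof (rule weights_addr.AE_pair_measure)
    show "{z \<in> space (measure_pmf weights \<Otimes>\<^sub>M addr). Q (case z of (n, x) \<Rightarrow> orb n x)}
        \<in> sets (measure_pmf weights \<Otimes>\<^sub>M addr)"
    proof -
      have "(\<lambda>(n, x). orb n x) -` {r \<in> space coded_space. Q r} \<inter> space (measure_pmf weights \<Otimes>\<^sub>M addr)
          \<in> sets (measure_pmf weights \<Otimes>\<^sub>M addr)"
        using Q by measurable
      also have "(\<lambda>(n, x). orb n x) -` {r \<in> space coded_space. Q r} \<inter> space (measure_pmf weights \<Otimes>\<^sub>M addr)
          = {z \<in> space (measure_pmf weights \<Otimes>\<^sub>M addr). Q (case z of (n, x) \<Rightarrow> orb n x)}"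
        using orb_in_space by auto
      finally show ?thesis .
    qed
  qed (simp add: ae)
  then show ?thesis
    unfolding sys_measure_def using Q by (subst AE_distr_iff) auto
qed

lemma null_sys_iff:
  assumes B: "B \<in> sets coded_space"
  shows "emeasure sys_measure B = 0 \<longleftrightarrow> (\<forall>n. AE x in addr. orb n x \<notin> B)"
proof -
  have "emeasure sys_measure B = 0 \<longleftrightarrow> (AE r in sys_measure. r \<notin> B)"
    using B by (intro AE_iff_measurable[symmetric]) (auto dest: sets.sets_into_space)
  also have "\<dots> \<longleftrightarrow> (\<forall>n. AE x in addr. orb n x \<notin> B)"
    using AE_sys_imp[of "\<lambda>r. r \<notin> B"] AE_sysI[of "\<lambda>r. r \<notin> B"] B
    by (auto simp: AE_all_countable set_diff_eq[symmetric])
  finally show ?thesis .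
qed

lemma bij_translate: "bij_betw (translate m) (space coded_space) (space coded_space)"
proof (rule bij_betw_byWitness)
  show "\<forall>r\<in>space coded_space. translate (- m) (translate m r) = r"
    "\<forall>r\<in>space coded_space. translate m (translate (- m) r) = r"
    by (auto simp: translate_add translate_0)
qed (auto simp: space_coded)

lemma inv_into_translate: "r \<in> space coded_space \<Longrightarrow> inv_into (space coded_space) (translate m) r = translate (- m) r"
  using bij_translate[of m]
  by (intro inv_into_f_eq) (auto simp: bij_betw_def translate_add translate_0 measurable_space[OF measurable_translate])

text \<open>By \<open>null_sys_iff\<close> a null set is described by conditions indexed by all
  integers, and the translation only shifts the index.\<close>

lemma nonsingular_sys: "nonsingular_Z_system sys_measure (translate 1)"
  unfolding nonsingular_Z_system_def
proof (intro conjI ballI)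
  have "standard_borel sys_measure" by (rule standard_borel_embed_measure[OF inj_to_real]) simp
  then show "standard_prob_space sys_measure"
    by (simp add: standard_prob_space_def prob_space_sys)
  show "bij_betw (translate 1) (space sys_measure) (space sys_measure)"
    by (simp add: bij_translate)
  show "translate 1 \<in> measurable sys_measure sys_measure" by measurable
  have "inv_into (space coded_space) (translate 1) \<in> measurable coded_space coded_space"
    using measurable_translate[of "-1"] by (simp add: inv_into_translate cong: measurable_cong)
  then show "inv_into (space sys_measure) (translate 1) \<in> measurable sys_measure sys_measure"
    by (simp add: measurable_cong_sets[OF sets_sys sets_sys])
  fix B assume "B \<in> sets sys_measure"
  then have B: "B \<in> sets coded_space" "B \<subseteq> space coded_space" using sets.sets_into_space by auto
  have image: "translate 1 ` B = translate (-1) -` B \<inter> space coded_space"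
  proof (intro equalityI subsetI)
    fix r assume "r \<in> translate 1 ` B"
    then show "r \<in> translate (-1) -` B \<inter> space coded_space"
      using B(2) by (auto simp: translate_add translate_0 subset_eq measurable_space[OF measurable_translate])
  next
    fix r assume r: "r \<in> translate (-1) -` B \<inter> space coded_space"
    then have "r = translate 1 (translate (-1) r)" by (simp add: translate_add translate_0)
    with r show "r \<in> translate 1 ` B" by blast
  qed
  have "translate 1 ` B \<in> sets coded_space"
    unfolding image using B(1) by measurable
  then have "emeasure sys_measure (translate 1 ` B) = 0 \<longleftrightarrow> (\<forall>n. AE x in addr. orb n x \<notin> translate 1 ` B)"
    by (rule null_sys_iff)
  also have "\<dots> \<longleftrightarrow> (\<forall>n. AE x in addr. orb (n - 1) x \<notin> B)"
    by (simp add: image orb_in_space translate_orb)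
  also have "\<dots> \<longleftrightarrow> (\<forall>n. AE x in addr. orb n x \<notin> B)"
  proof (intro iffI allI)
    fix n assume "\<forall>n. AE x in addr. orb (n - 1) x \<notin> B"
    from this[rule_format, of "n + 1"] show "AE x in addr. orb n x \<notin> B" by simp
  qed simp
  also have "\<dots> \<longleftrightarrow> emeasure sys_measure B = 0" using B(1) by (rule null_sys_iff[symmetric])
  finally show "emeasure sys_measure (translate 1 ` B) = 0 \<longleftrightarrow> emeasure sys_measure B = 0" .
qed

section \<open>Failure of double ergodicity\<close>

definition meet :: "real \<Rightarrow> real \<Rightarrow> int set" where
  "meet a b = {n. inv to_real a n = 1 \<and> inv to_real b n = 1}"

lemma meet_orb: "meet (orb 0 x) (orb 0 y) = occ x \<inter> occ y"
  by (auto simp: meet_def orb_def code_def indicator_def)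

lemma meet_translate:
  assumes "a \<in> space coded_space" "b \<in> space coded_space"
  shows "meet (translate m a) (translate m b) = (\<lambda>n. n - m) ` meet a b"
  using assms by (force simp: space_coded meet_def shift_def image_iff)

lemma prob_digit_match:
  assumes "x \<in> addresses"
  shows "addr.P.prob {y \<in> space addr. fst (y k) = fst (x k)} = 1 / 2 ^ (k + 2)"
proof -
  obtain n j where nj: "x k = (n, j)" "2 ^ (k + 2) \<le> n" "n < 2 ^ (k + 3)" "j < 3"
    using assms digitsE[of "x k" k] by (metis PiE UNIV_I)
  define A where "A = {n} \<times> {..<3 :: nat}"
  have A: "A \<subseteq> digits k" using nj by (auto simp: A_def digits_def)
  have "fst w = fst (x k) \<longleftrightarrow> w \<in> A" if "w \<in> digits k" for w
    using that nj(1) by (auto simp: A_def digits_def mem_Times_iff)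
  then have "{y \<in> space addr. fst (y k) = fst (x k)} = {y \<in> space addr. y k \<in> A}"
    unfolding space_addr by (intro Collect_cong conj_cong refl) (simp add: Pi_iff)
  then have "emeasure addr {y \<in> space addr. fst (y k) = fst (x k)} = emeasure (uniform_count_measure (digits k)) A"
    using A addr.emeasure_PiM_Collect_single[of k A] by (simp add: sets_uniform_count_measure)
  also have "\<dots> = ennreal (card A / card (digits k))"
    using A by (simp add: emeasure_uniform_count_measure finite_digits)
  also have "card A / card (digits k) = 1 / 2 ^ (k + 2)"
    by (simp add: card_digits A_def card_cartesian_product)
  finally show ?thesis by (simp add: measure_def)
qed

lemma measurable_digit[measurable]: "Measurable.pred addr (\<lambda>y. Q (y k))"
proof -
  have "Measurable.pred (uniform_count_measure (digits k)) Q"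
    by (auto simp: pred_def sets_uniform_count_measure space_uniform_count_measure)
  then show ?thesis
    by (rule measurable_compose[OF measurable_component_singleton, rotated]) simp
qed

text \<open>Union bound: the coincidence probabilities \<open>1 / 2 ^ (k + 2)\<close> add up to 1/2,
  so with positive probability no digit matches in its first component.\<close>

lemma not_AE_match:
  assumes x: "x \<in> addresses"
  shows "\<not> (AE y in addr. \<exists>k. fst (y k) = fst (x k))"
proof
  let ?A = "\<lambda>k. {y \<in> space addr. fst (y k) = fst (x k)}"
  assume "AE y in addr. \<exists>k. fst (y k) = fst (x k)"
  then have "AE y in addr. y \<in> (\<Union>k. ?A k)"
    using AE_space by eventually_elim auto
  moreover have A: "?A k \<in> sets addr" for k by (rule predE, rule measurable_digit)
  ultimately have "1 = addr.P.prob (\<Union>k. ?A k)"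
    using addr.P.prob_eq_1[of "\<Union>k. ?A k"] A by auto
  also have "\<dots> \<le> (\<Sum>k. addr.P.prob (?A k))"
  proof (rule addr.P.finite_measure_subadditive_countably)
    show "summable (\<lambda>k. addr.P.prob (?A k))"
      using summable_mult2[OF summable_geometric[of "1 / 2 :: real"], of "1 / 4"]
      unfolding prob_digit_match[OF x] by (simp add: power_add power_divide mult.commute)
  qed (use A in auto)
  also have "\<dots> = (\<Sum>k. (1 / 2) ^ k * (1 / 4))"
    unfolding prob_digit_match[OF x] by (simp add: power_add power_divide mult.commute)
  also have "\<dots> = (\<Sum>k. (1 / 2) ^ k) * (1 / 4 :: real)"
    by (rule suminf_mult2[symmetric]) (simp add: summable_geometric)
  also have "\<dots> = 1 / 2" by (simp add: suminf_geometric)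
  finally show False by simp
qed

text \<open>The digit at 0 is uniform on a finite set, so it hits \<open>x 0\<close> with positive
  probability.\<close>

lemma not_AE_mismatch:
  assumes x: "x \<in> addresses"
  shows "\<not> (AE y in addr. y 0 \<noteq> x 0)"
proof
  assume "AE y in addr. y 0 \<noteq> x 0"
  moreover have x0: "x 0 \<in> digits 0" using x by auto
  then have S: "{x 0} \<in> sets (uniform_count_measure (digits 0))" by (simp add: sets_uniform_count_measure)
  moreover have "{y \<in> space addr. y 0 \<in> {x 0}} \<in> sets addr"
    by (rule predE, rule measurable_digit)
  ultimately have "emeasure addr {y \<in> space addr. y 0 \<in> {x 0}} = 0"
    by (subst AE_iff_measurable[symmetric, where P = "\<lambda>y. y 0 \<noteq> x 0"]) auto
  then show False
    using addr.emeasure_PiM_Collect_single[of 0 "{x 0}", OF _ S] x0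
    by (simp add: emeasure_uniform_count_measure finite_digits card_digits)
qed

text \<open>The diagonal action moves \<open>meet\<close> rigidly, so the set \<open>B\<close> of
  pairs with exactly one common time is invariant. Ergodicity would decide membership in
  \<open>B\<close> almost everywhere, although both kinds of pairs have positive
  probability.\<close>

lemma not_doubly_ergodic_sys: "\<not> doubly_ergodic sys_measure (translate 1)"
proof
  define TT where "TT = (\<lambda>(a, b). (translate 1 a, translate 1 b))"
  define B where "B = {z \<in> space (coded_space \<Otimes>\<^sub>M coded_space). \<exists>n. n \<in> meet (fst z) (snd z) \<and> (\<forall>m. m \<in> meet (fst z) (snd z) \<longrightarrow> m = n)}"
  interpret pair_prob_space sys_measure sys_measure ..
  have sets: "sets (sys_measure \<Otimes>\<^sub>M sys_measure) = sets (coded_space \<Otimes>\<^sub>M coded_space)"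
    by (intro sets_pair_measure_cong) auto
  have [measurable]: "(\<lambda>z. inv to_real (fst z) n) \<in> borel_measurable (coded_space \<Otimes>\<^sub>M coded_space)"
     "(\<lambda>z. inv to_real (snd z) n) \<in> borel_measurable (coded_space \<Otimes>\<^sub>M coded_space)" for n
    using measurable_compose[OF measurable_fst measurable_coordinate]
      measurable_compose[OF measurable_snd measurable_coordinate] by blast+
  have B_sets: "B \<in> sets (coded_space \<Otimes>\<^sub>M coded_space)"
    unfolding B_def meet_def by measurable
  have mem_B: "(a, b) \<in> B \<longleftrightarrow> (\<exists>n. meet a b = {n})" if "a \<in> space coded_space" "b \<in> space coded_space" for a b
    using that by (auto simp: B_def space_pair_measure)
  have B_translate: "(translate m a, translate m b) \<in> B \<longleftrightarrow> (a, b) \<in> B"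
    if "a \<in> space coded_space" "b \<in> space coded_space" for a b m
  proof -
    have "(\<exists>n. (\<lambda>n. n - m) ` S = {n}) \<longleftrightarrow> (\<exists>n. S = {n})" for S :: "int set"
    proof -
      have "card ((\<lambda>n. n - m) ` S) = card S" by (rule card_image) (auto simp: inj_on_def)
      then show ?thesis unfolding card_1_singleton_iff[symmetric] by simp
    qed
    then show ?thesis
      using that mem_B measurable_space[OF measurable_translate] meet_translate by simp
  qed
  have "TT ` B = B"
  proof (intro equalityI subsetI)
    fix z assume "z \<in> TT ` B"
    then obtain a b where ab: "(a, b) \<in> B" "z = (translate 1 a, translate 1 b)" by (auto simp: TT_def)
    then have "a \<in> space coded_space" "b \<in> space coded_space" by (auto simp: B_def space_pair_measure)
    with ab show "z \<in> B" by (simp add: B_translate)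
  next
    fix z assume "z \<in> B"
    then obtain a b where ab: "z = (a, b)" "(a, b) \<in> B" "a \<in> space coded_space" "b \<in> space coded_space"
      by (cases z) (auto simp: B_def space_pair_measure)
    then have "(translate (-1) a, translate (-1) b) \<in> B" by (simp add: B_translate)
    moreover have "z = TT (translate (-1) a, translate (-1) b)"
      using ab by (simp add: TT_def translate_add translate_0)
    ultimately show "z \<in> TT ` B" by blast
  qed
  moreover assume "doubly_ergodic sys_measure (translate 1)"
  ultimately consider "measure (sys_measure \<Otimes>\<^sub>M sys_measure) B = 0" | "measure (sys_measure \<Otimes>\<^sub>M sys_measure) B = 1"
    unfolding doubly_ergodic_def ergodic_def TT_def[symmetric] using B_sets sets by fastforce
  then obtain b where ae: "AE z in sys_measure \<Otimes>\<^sub>M sys_measure. z \<in> B \<longleftrightarrow> b"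
  proof cases
    case 1
    then have "B \<in> null_sets (sys_measure \<Otimes>\<^sub>M sys_measure)"
      using B_sets sets by (auto simp: null_sets_def emeasure_eq_measure)
    from AE_not_in[OF this] show ?thesis using that[of False] by simp
  next
    case 2
    then show ?thesis using that[of True] prob_eq_1[of B] B_sets sets by simp
  qed
  have "AE a in sys_measure. AE c in sys_measure. (a, c) \<in> B \<longleftrightarrow> b" by (rule AE_pair[OF ae])
  \<comment> \<open>\<open>AE_sys_imp\<close> speaks of every translate; index 0 selects the base
    points, for which \<open>meet\<close> is the intersection of the sets
    \<open>occ\<close>.\<close>
  then have "AE x in addr. AE c in sys_measure. (orb 0 x, c) \<in> B \<longleftrightarrow> b"
    by (auto dest: AE_sys_imp elim: eventually_mono)
  then obtain x where x: "x \<in> addresses" "AE c in sys_measure. (orb 0 x, c) \<in> B \<longleftrightarrow> b"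
    using AE_space addr.P.AE_False by (metis (no_types, lifting) AE_E2 AE_mp AE_I2 space_addr)
  from x(2) have "AE y in addr. (orb 0 x, orb 0 y) \<in> B \<longleftrightarrow> b"
    by (auto dest: AE_sys_imp elim: eventually_mono)
  then have *: "AE y in addr. (\<exists>n. occ x \<inter> occ y = {n}) \<longleftrightarrow> b"
    by (simp add: mem_B orb_in_space meet_orb)
  \<comment> \<open>If \<open>b\<close> holds, a common digit at 0 yields a second common return
    time. Otherwise addresses without any match in the first components contradict \<open>*\<close>,
    since they meet in \<open>{0}\<close>. Each event has positive probability.\<close>
  show False
  proof (cases b)
    case True
    have "AE y in addr. y 0 \<noteq> x 0"
      using * AE_space
    proof eventually_elim
      case (elim y)
      show ?case
      proof
        assume "y 0 = x 0"
        with occ_common[of x y] x(1) elim(2) obtain n where "n \<noteq> 0" "n \<in> occ x \<inter> occ y"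
          unfolding space_addr by metis
        moreover have "0 \<in> occ x \<inter> occ y" using zero_in_occ x(1) elim(2) unfolding space_addr by blast
        ultimately show False using elim(1) True by (metis singletonD)
      qed
    qed
    then show False using not_AE_mismatch[OF x(1)] by blast
  next
    case False
    have "AE y in addr. \<exists>k. fst (y k) = fst (x k)"
      using * AE_space
    proof eventually_elim
      case (elim y)
      show ?case
        using occ_disjoint[of x y] x(1) elim False unfolding space_addr by metis
    qed
    then show False using not_AE_match[OF x(1)] by blast
  qed
qed

section \<open>Isometric coefficients\<close>

lemma AE_fst_addr:
  assumes "AE x in addr. Q x"
  shows "AE z in addr \<Otimes>\<^sub>M addr. Q (fst z)"
proof (rule AE_distrD[OF measurable_fst])
  show "AE x in distr (addr \<Otimes>\<^sub>M addr) addr fst. Q x"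
    using assms by (simp only: addr.P.distr_pair_fst[of addr])
qed

lemma isometric_coefficient_sys_constant:
  assumes coeff: "isometric_coefficient sys_measure (translate 1) Z d U \<phi>"
  shows "\<exists>c\<in>Z. AE r in sys_measure. \<phi> r = c"
proof -
  have ms: "Metric_space Z d"
    and sep: "separable_space (Metric_space.mtopology Z d)"
    and bij: "bij_betw U Z Z"
    and iso: "\<And>x y. x \<in> Z \<Longrightarrow> y \<in> Z \<Longrightarrow> d (U x) (U y) = d x y"
    and meas: "\<phi> \<in> measurable sys_measure (sigma Z {V. openin (Metric_space.mtopology Z d) V})"
    and equiv: "AE r in sys_measure. \<phi> (translate 1 r) = U (\<phi> r)"
    using coeff by (auto simp: isometric_coefficient_def)
  interpret Metric_space Z d by fact
  have UZ: "U z \<in> Z" if "z \<in> Z" for z using bij that by (auto simp: bij_betw_def)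
  obtain C where C: "countable C" "C \<subseteq> Z" "mtopology closure_of C = Z"
    using sep by (auto simp: separable_space_def)
  have dense: "\<exists>c\<in>C. z \<in> mball c e" if "z \<in> Z" "0 < e" for z e
  proof -
    have "z \<in> mtopology closure_of C" using C that by simp
    then have "\<exists>c\<in>C. c \<in> mball z e" using that(2) unfolding metric_closure_of mem_Collect_eq by blast
    then show ?thesis by (auto simp: commute)
  qed
  have subZ: "{V. openin mtopology V} \<subseteq> Pow Z"
    using openin_subset by fastforce
  have \<phi>Z: "\<phi> r \<in> Z" if "r \<in> space coded_space" for r
    using measurable_space[OF meas, of r] that subZ by (simp add: space_measure_of)
  have \<phi>_open: "{r \<in> space coded_space. \<phi> r \<in> V} \<in> sets coded_space" if "openin mtopology V" for V
  proof -
    have "V \<in> sets (sigma Z {V. openin mtopology V})"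
      using that subZ by (simp add: sets_measure_of sigma_sets.Basic)
    from measurable_sets[OF meas this] show ?thesis
      by (simp add: vimage_def Int_def conj_commute)
  qed

  \<comment> \<open>From here on \<open>\<phi>\<close> is read on addresses: a finite change of
    digits turns into a shift of the index \<open>n\<close>, and equivariance into an application of
    \<open>U\<close>.\<close>
  define \<theta> where "\<theta> n x = \<phi> (orb n x)" for n x
  have \<theta>Z: "\<theta> n x \<in> Z" for n x by (simp add: \<theta>_def \<phi>Z orb_in_space)
  have \<theta>_open: "{x \<in> space addr. \<theta> n x \<in> V} \<in> sets addr" if "openin mtopology V" for n V
  proof -
    have "orb n -` {r \<in> space coded_space. \<phi> r \<in> V} \<inter> space addr \<in> sets addr"
      using \<phi>_open[OF that] by measurable
    also have "orb n -` {r \<in> space coded_space. \<phi> r \<in> V} \<inter> space addr = {x \<in> space addr. \<theta> n x \<in> V}"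
      by (auto simp: \<theta>_def orb_in_space)
    finally show ?thesis .
  qed
  have \<theta>_change: "\<theta> n y = \<theta> (n + (height K y - height K x)) x"
    if "x \<in> addresses" "y \<in> addresses" "\<And>k. K \<le> k \<Longrightarrow> x k = y k" for n x y K
    using code_change[of x y K, OF that] by (simp add: \<theta>_def orb_def shift_shift)

  \<comment> \<open>Equivariance along the whole two-sided orbit; it lets shifts of the index act
    isometrically, negative ones included.\<close>
  define good where "good x \<longleftrightarrow> (\<forall>n. \<theta> (n + 1) x = U (\<theta> n x))" for x
  have AE_good: "AE x in addr. good x"
    using AE_sys_imp[OF equiv] by (simp add: good_def \<theta>_def translate_orb add.commute)
  have isometry: "d (\<theta> (m + k) x) (\<theta> (n + k) x) = d (\<theta> m x) (\<theta> n x)" if "good x" for x m n k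
  proof -
    have step: "d (\<theta> (m + 1) x) (\<theta> (n + 1) x) = d (\<theta> m x) (\<theta> n x)" for m n
      using that iso \<theta>Z by (simp add: good_def)
    show ?thesis
    proof (induction k rule: int_induct[where k = 0])
      case (step1 i)
      then show ?case using step[of "m + i" "n + i"] by (simp add: add.assoc)
    next
      case (step2 i)
      then show ?case using step[of "m + (i - 1)" "n + (i - 1)"] by simp
    qed simp
  qed

  \<comment> \<open>The set of points that \<open>U\<close> displaces by less than \<open>e\<close>
    is open. Countably many balls of radius \<open>e / 8\<close> cover \<open>Z\<close>, and for
    each of them a full fibre of three digits landing in the ball forces a small
    displacement.\<close>
  have small: "AE x in addr. d (\<theta> 0 x) (\<theta> 1 x) < e" if e: "0 < e" for e
  proof -
    define V where "V = {z \<in> Z. d z (U z) < e}"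
    have V: "openin mtopology V"
      unfolding openin_mtopology
    proof (intro conjI allI impI)
      show "V \<subseteq> Z" by (auto simp: V_def)
      fix z assume z: "z \<in> V"
      \<comment> \<open>Half the slack: replacing \<open>z\<close> by a point within
        \<open>r\<close> raises the displacement by less than \<open>2 * r\<close>.\<close>
      define r where "r = (e - d z (U z)) / 2"
      have "mball z r \<subseteq> V"
      proof
        fix w assume "w \<in> mball z r"
        then have w: "z \<in> Z" "w \<in> Z" "d z w < r" by auto
        have "d w (U w) \<le> d w z + (d z (U z) + d (U z) (U w))"
          using triangle[of w z "U w"] triangle[of z "U z" "U w"] w UZ by fastforce
        then have "d w (U w) < e" using w iso[OF w(1,2)] commute[of w z] by (simp add: r_def field_simps)
        with w show "w \<in> V" by (simp add: V_def)
      qed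
      moreover have "0 < r" using z by (simp add: V_def r_def)
      ultimately show "\<exists>r>0. mball z r \<subseteq> V" by blast
    qed
    have null: "AE x in addr. \<theta> 0 x \<in> mball c (e / 8) \<longrightarrow> \<theta> 0 x \<in> V" if "c \<in> C" for c
    proof (rule ccontr)
      assume not: "\<not> (AE x in addr. \<theta> 0 x \<in> mball c (e / 8) \<longrightarrow> \<theta> 0 x \<in> V)"
      \<comment> \<open>The addresses that are not \<open>good\<close> are covered by a measurable
        null set, whose removal keeps \<open>E\<close> measurable.\<close>
      obtain N where N: "N \<in> null_sets addr" "{x \<in> space addr. \<not> good x} \<subseteq> N"
        using AE_good by (auto simp: eventually_ae_filter)
      define E where "E = {x \<in> space addr. \<theta> 0 x \<in> mball c (e / 8)} - {x \<in> space addr. \<theta> 0 x \<in> V} - N"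
      have E: "E \<in> sets addr"
        unfolding E_def using \<theta>_open[OF V] \<theta>_open[OF openin_mball] N(1) by blast
      have "addr.P.prob E \<noteq> 0"
      proof
        assume "addr.P.prob E = 0"
        then have "AE x in addr. x \<notin> E" using E addr.P.prob_eq_0 by blast
        moreover have "AE x in addr. x \<notin> N" using N(1) by (rule AE_not_in)
        ultimately have "AE x in addr. \<theta> 0 x \<in> mball c (e / 8) \<longrightarrow> \<theta> 0 x \<in> V"
          using AE_space by eventually_elim (auto simp: E_def)
        with not show False ..
      qed
      then have "addr.P.prob E > 0" by (simp add: zero_less_measure_iff)
      from full_fibre[OF E this] obtain K x n where fibre: "\<And>j. j < 3 \<Longrightarrow> x(K := (n, j)) \<in> E"
        by blast
      define y where "y j = x(K := (n, j))" for j
      have y: "y j \<in> addresses" "d c (\<theta> 0 (y j)) < e / 8" if "j < 3" for j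
        using fibre[OF that] by (auto simp: y_def E_def space_addr)
      have "good (y 0)" "\<theta> 0 (y 0) \<notin> V"
        using fibre[of 0] N(2) by (auto simp: y_def E_def)
      define a where "a = (16::int) ^ (2 * n)"
      have \<theta>y: "\<theta> 0 (y j) = \<theta> (int j * a + (if j = 2 then 1 else 0)) (y 0)" if "j < 3" for j
      proof -
        \<comment> \<open>\<open>Suc K\<close>, since the fibre varies the digit at \<open>K\<close>
          itself.\<close>
        have "height (Suc K) (y j) - height (Suc K) (y 0) = int j * a + (if j = 2 then 1 else 0)"
          by (simp add: height_Suc) (simp add: height_def y_def jump_def a_def)
        moreover have "\<theta> 0 (y j) = \<theta> (0 + (height (Suc K) (y j) - height (Suc K) (y 0))) (y 0)"
          using y that by (intro \<theta>_change) (auto simp: y_def)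
        ultimately show ?thesis by simp
      qed
      let ?t = "\<lambda>m. \<theta> m (y 0)"
      have near: "d c (?t 0) < e / 8" "d c (?t a) < e / 8" "d c (?t (2 * a + 1)) < e / 8"
        using y(2)[of 0] y(2)[of 1] y(2)[of 2] \<theta>y[of 1] \<theta>y[of 2] by auto
      have cZ: "c \<in> Z" using C \<open>c \<in> C\<close> by auto
      have tri: "d u v \<le> d c u + d c v" if "u \<in> Z" "v \<in> Z" for u v
        using triangle[of u c v] cZ that commute[of u c] by simp
      txt \<open>\<open>U\<^sup>a\<close> and \<open>U\<^sup>a\<^sup>+\<^sup>1\<close> both nearly fix a point, hence so does \<open>U\<close>.\<close>
      have "d (?t a) (?t 0) < e / 4" using tri[OF \<theta>Z \<theta>Z, of a "y 0" 0 "y 0"] near by simp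
      then have "d (?t (2 * a + 1)) (?t (a + 1)) < e / 4"
        using isometry[OF \<open>good (y 0)\<close>, of a "a + 1" 0] by (simp add: algebra_simps)
      moreover have "d (?t a) (?t (2 * a + 1)) < e / 4"
        using tri[OF \<theta>Z \<theta>Z, of a "y 0" "2 * a + 1" "y 0"] near by simp
      ultimately have "d (?t a) (?t (a + 1)) < e"
        using triangle[of "?t a" "?t (2 * a + 1)" "?t (a + 1)"] \<theta>Z e by simp
      then have "d (?t 0) (?t 1) < e"
        using isometry[OF \<open>good (y 0)\<close>, of 0 a 1] by (simp add: add.commute)
      moreover have "?t 1 = U (?t 0)" using \<open>good (y 0)\<close>[unfolded good_def, rule_format, of 0] by simp
      ultimately show False using \<open>\<theta> 0 (y 0) \<notin> V\<close> \<theta>Z by (simp add: V_def)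
    qed
    have "AE x in addr. \<forall>c\<in>C. \<theta> 0 x \<in> mball c (e / 8) \<longrightarrow> \<theta> 0 x \<in> V"
      unfolding AE_ball_countable[OF C(1)] using null by blast
    then show ?thesis using AE_good
    proof eventually_elim
      case (elim x)
      obtain c where "c \<in> C" "\<theta> 0 x \<in> mball c (e / 8)" using dense[OF \<theta>Z, of "e / 8"] e by auto
      then have "\<theta> 0 x \<in> V" using elim(1) by blast
      moreover have "\<theta> 1 x = U (\<theta> 0 x)" using elim(2)[unfolded good_def, rule_format, of 0] by simp
      ultimately show ?case by (simp add: V_def)
    qed
  qed

  \<comment> \<open>Letting \<open>e\<close> run through \<open>1 / real (Suc i)\<close> leaves
    displacement 0 at \<open>\<theta> 0 x\<close>, and \<open>isometry\<close> carries this to every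
    index.\<close>
  have fixed: "AE x in addr. \<forall>n. \<theta> n x = \<theta> 0 x"
  proof -
    have "AE x in addr. \<forall>i::nat. d (\<theta> 0 x) (\<theta> 1 x) < 1 / real (Suc i)"
      unfolding AE_all_countable using small by simp
    then show ?thesis using AE_good
    proof eventually_elim
      case (elim x)
      have "d (\<theta> 0 x) (\<theta> 1 x) \<le> 0"
      proof (rule ccontr)
        assume "\<not> d (\<theta> 0 x) (\<theta> 1 x) \<le> 0"
        then obtain i where "inverse (real (Suc i)) < d (\<theta> 0 x) (\<theta> 1 x)"
          using reals_Archimedean[of "d (\<theta> 0 x) (\<theta> 1 x)"] by auto
        with elim(1) show False by (simp add: inverse_eq_divide) (metis less_asym)
      qed
      then have "d (\<theta> 0 x) (\<theta> 1 x) = 0" by (simp add: order_antisym)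
      then have "d (\<theta> n x) (\<theta> (n + 1) x) = 0" for n
        using isometry[OF elim(2), of 0 n 1] by (simp add: add.commute)
      then have step: "\<theta> (n + 1) x = \<theta> n x" for n using zero \<theta>Z by metis
      show ?case
      proof
        fix n show "\<theta> n x = \<theta> 0 x"
        proof (induction n rule: int_induct[where k = 0])
          case (step1 i)
          then show ?case using step[of i] by simp
        next
          case (step2 i)
          then show ?case using step[of "i - 1"] by simp
        qed simp
      qed
    qed
  qed

  \<comment> \<open>A finite change of digits only shifts the index of \<open>\<theta>\<close>,
    which by \<open>fixed\<close> leaves the value alone almost everywhere, so splicing does not
    affect the event.\<close>
  have zero_one: "addr.P.prob {x \<in> space addr. \<theta> 0 x \<in> V} = 0 \<or> addr.P.prob {x \<in> space addr. \<theta> 0 x \<in> V} = 1"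
    if V: "openin mtopology V" for V
  proof (rule addr.zero_one_splice[OF \<theta>_open[OF V]])
    fix J :: "nat set" assume "finite J"
    then obtain K where K: "J \<subseteq> {..<K}" using finite_nat_iff_bounded by blast
    show "AE z in addr \<Otimes>\<^sub>M addr. addr.splice J z \<in> {x \<in> space addr. \<theta> 0 x \<in> V}
        \<longleftrightarrow> fst z \<in> {x \<in> space addr. \<theta> 0 x \<in> V}"
      using AE_fst_addr[OF fixed] AE_space
    proof eventually_elim
      case (elim z)
      have z: "fst z \<in> addresses" "addr.splice J z \<in> addresses"
        using elim(2) measurable_space[OF addr.measurable_splice elim(2), of J]
        by (auto simp: space_pair_measure space_addr)
      have "\<theta> 0 (addr.splice J z) = \<theta> (0 + (height K (addr.splice J z) - height K (fst z))) (fst z)"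
        using z K by (intro \<theta>_change) (auto simp: addr.splice_def)
      also have "\<dots> = \<theta> 0 (fst z)" using elim(1) by blast
      finally show ?case using z by (simp add: space_addr)
    qed
  qed

  \<comment> \<open>For each radius countably many balls cover \<open>Z\<close>, and each has
    probability 0 or 1, so one of them has probability 1.\<close>
  have "\<exists>c\<in>C. AE x in addr. \<theta> 0 x \<in> mball c (1 / real (Suc i))" for i
  proof (rule ccontr)
    let ?E = "\<lambda>c. {x \<in> space addr. \<theta> 0 x \<in> mball c (1 / real (Suc i))}"
    assume not: "\<not> (\<exists>c\<in>C. AE x in addr. \<theta> 0 x \<in> mball c (1 / real (Suc i)))"
    have E: "?E c \<in> sets addr" for c by (rule \<theta>_open) simp
    have "AE x in addr. x \<notin> ?E c" if "c \<in> C" for c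
    proof -
      have "addr.P.prob (?E c) \<noteq> 1"
      proof
        assume "addr.P.prob (?E c) = 1"
        then have "AE x in addr. x \<in> ?E c" using addr.P.prob_eq_1[OF E] by blast
        then have "AE x in addr. \<theta> 0 x \<in> mball c (1 / real (Suc i))" by (rule AE_mp) simp
        with not that show False by blast
      qed
      then have "addr.P.prob (?E c) = 0" using zero_one[OF openin_mball] by blast
      then show ?thesis using addr.P.prob_eq_0[OF E] by blast
    qed
    then have "AE x in addr. \<forall>c\<in>C. x \<notin> ?E c" unfolding AE_ball_countable[OF C(1)] by blast
    then have "AE x in addr. False"
      using AE_space
    proof eventually_elim
      case (elim x)
      then show ?case using dense[OF \<theta>Z, of "1 / real (Suc i)" 0 x] by auto
    qed
    then show False by (rule addr.P.AE_False[THEN iffD1])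
  qed
  then obtain c where c: "\<And>i. c i \<in> C" "\<And>i. AE x in addr. \<theta> 0 x \<in> mball (c i) (1 / real (Suc i))"
    by metis
  have near: "AE x in addr. \<forall>i. \<theta> 0 x \<in> mball (c i) (1 / real (Suc i))"
    unfolding AE_all_countable using c(2) by blast
  \<comment> \<open>A single address whose value lies in all the chosen balls. As the radii tend to
    0, any other such address has the same value.\<close>
  obtain x0 where x0: "\<And>i. \<theta> 0 x0 \<in> mball (c i) (1 / real (Suc i))"
    using eventually_happens[OF near] addr.P.ae_filter_bot by blast
  have const: "AE x in addr. \<forall>n. \<theta> n x = \<theta> 0 x0"
    using near fixed
  proof eventually_elim
    case (elim x)
    have "d (\<theta> 0 x) (\<theta> 0 x0) \<le> 0"
    proof (rule ccontr)
      assume "\<not> d (\<theta> 0 x) (\<theta> 0 x0) \<le> 0"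
      then obtain i where "inverse (real (Suc i)) < d (\<theta> 0 x) (\<theta> 0 x0) / 2"
        using reals_Archimedean[of "d (\<theta> 0 x) (\<theta> 0 x0) / 2"] by auto
      moreover have "d (\<theta> 0 x) (\<theta> 0 x0) \<le> d (c i) (\<theta> 0 x) + d (c i) (\<theta> 0 x0)"
        using triangle[of "\<theta> 0 x" "c i" "\<theta> 0 x0"] \<theta>Z commute[of "c i"] x0[of i] by simp
      moreover have "d (c i) (\<theta> 0 x) < inverse (real (Suc i))" "d (c i) (\<theta> 0 x0) < inverse (real (Suc i))"
        using elim(1) x0 by (auto simp: inverse_eq_divide)
      ultimately show False by linarith
    qed
    then have "d (\<theta> 0 x) (\<theta> 0 x0) = 0" by (simp add: order_antisym)
    then have "\<theta> 0 x = \<theta> 0 x0" using zero \<theta>Z by metis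
    with elim(2) show ?case by simp
  qed
  \<comment> \<open>Points are closed in a metric space, so the level set is measurable, as
    \<open>AE_sysI\<close> requires.\<close>
  have "{r \<in> space coded_space. \<phi> r = \<theta> 0 x0} \<in> sets coded_space"
  proof -
    have "closedin mtopology {\<theta> 0 x0}" by (simp add: closedin_Hausdorff_finite Hausdorff_space_mtopology \<theta>Z)
    then have "openin mtopology (Z - {\<theta> 0 x0})" by (auto simp: closedin_def)
    from \<phi>_open[OF this] have "space coded_space - {r \<in> space coded_space. \<phi> r \<in> Z - {\<theta> 0 x0}} \<in> sets coded_space" by blast
    also have "space coded_space - {r \<in> space coded_space. \<phi> r \<in> Z - {\<theta> 0 x0}} = {r \<in> space coded_space. \<phi> r = \<theta> 0 x0}"
      using \<phi>Z by auto
    finally show ?thesis .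
  qed
  then have "AE r in sys_measure. \<phi> r = \<theta> 0 x0"
    using const by (intro AE_sysI) (auto simp: \<theta>_def AE_all_countable)
  then show ?thesis using \<theta>Z by blast
qed

theorem proposition6p1:
  shows "\<exists>(M :: real measure) T.
           nonsingular_Z_system M T \<and> EIC M T \<and> \<not> doubly_ergodic M T"
proof (intro exI conjI)
  show "EIC sys_measure (translate 1)"
    unfolding EIC_def using isometric_coefficient_sys_constant by blast
qed (fact nonsingular_sys not_doubly_ergodic_sys)+

end
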